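(* Let $\mathcal H$ be a real Hilbert space, let $M_1,\ldots,M_m$ be closed linear subspaces of $\mathcal H$, let $M:=\bigcap_{i=1}^m M_i$, $T:=P_{M_m}\cdots P_{M_1}$, and $Y:=M\oplus\sum_{i=1}^m M_i^\perp$. For $y_0\in\mathcal H$ put $y_k:=T^k(y_0)$, $k=1,2,\ldots$. Then: (A) For each $y_0\in\mathcal H$, as $k\to\infty$, $$\text{(A1)}\quad \|y_k-y_{k-1}\|=o(k^{-1}),\qquad \text{(A2)}\quad \sqrt{\tfrac1m\sum_{i=1}^m d^2(y_k,M_i)}=o(k^{-1/2}).$$ (B) For each $y_0\in Y$, as $k\to\infty$, $$\text{(B1)}\quad \|y_k-P_M(y_0)\|=\mathcal O(k^{-1/2}),\qquad \text{(B2)}\quad \|y_k-y_{k-1}\|=\mathcal O(k^{-3/2}),\qquad \text{(B3)}\quad \sqrt{\tfrac1m\sum_{i=1}^m d^2(y_k,M_i)}=\mathcal O(k^{-1}).$$ (C) If $\sum_{i=1}^m M_i^\perp$ is not closed, then all of these rates are best possible in the sense that the polynomials $k^{1/2},k,k^{3/2}$ cannot be replaced by $k^{1/2+\varepsilon},k^{1+\varepsilon},k^{3/2+\varepsilon}$, respectively, for any $\varepsilon>0$. That is, for every $\varepsilon>0$, each of the following five assertions is false: (A1$_\varepsilon$) $\|y_k-y_{k-1}\|=o(k^{-1-\varepsilon})$ for all $y_0\in\mathcal H$; (A2$_\varepsilon$) $\sqrt{\frac1m\sum_{i=1}^m d^2(y_k,M_i)}=o(k^{-1/2-\varepsilon})$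 for all $y_0\in\mathcal H$; (B1$_\varepsilon$) $\|y_k-P_M(y_0)\|=\mathcal O(k^{-1/2-\varepsilon})$ for all $y_0\in Y$; (B2$_\varepsilon$) $\|y_k-y_{k-1}\|=\mathcal O(k^{-3/2-\varepsilon})$ for all $y_0\in Y$; (B3$_\varepsilon$) $\sqrt{\frac1m\sum_{i=1}^m d^2(y_k,M_i)}=\mathcal O(k^{-1-\varepsilon})$ for all $y_0\in Y$.
   Context: For a closed linear subspace $L$ of $\mathcal H$, $P_L$ denotes the orthogonal projection onto $L$, $L^\perp$ the orthogonal complement, and $d(x,L)=\inf_{z\in L}\|x-z\|$. The sum $\sum_{i=1}^m M_i^\perp=\{x_1+\cdots+x_m: x_i\in M_i^\perp\}$ is algebraic (not closed up); it is orthogonal to $M$, and $M\oplus\sum_{i=1}^m M_i^\perp$ denotes the set of all $x_0+x$ with $x_0\in M$, $x\in\sum_{i=1}^m M_i^\perp$. The symbols $o(\cdot)$ and $\mathcal O(\cdot)$ refer to $k\to\infty$ for a fixed $y_0$; the implied constants may depend on $y_0$. *)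

theory Defs
  imports "HOL-Analysis.Analysis" "HOL-Library.Landau_Symbols"
begin

text \<open>
  A real Hilbert space is a type of sort \<open>{real_inner, complete_space}\<close>.  The library's
  \<open>closest_point\<close> needs \<open>heine_borel\<close>, i.e. finite dimension, so the orthogonal
  projection is defined here through the decomposition of \<open>x\<close> along \<open>L\<close> and
  its orthogonal complement.  For a closed subspace \<open>L\<close> the description is satisfied by
  exactly one point; for other sets the value is irrelevant.
\<close>

definition orth_proj :: "'a::{real_inner, complete_space} set \<Rightarrow> 'a \<Rightarrow> 'a" where
  "orth_proj L x = (THE p. p \<in> L \<and> x - p \<in> L\<^sup>\<bottom>)"

text \<open>The subspaces are \<open>M 1, \<dots>, M m\<close>; values of \<open>M\<close> at other indices are never used.\<close>

primrec proj_prod :: "(nat \<Rightarrow> 'a::{real_inner, complete_space} set) \<Rightarrow> nat \<Rightarrow> 'a \<Rightarrow> 'a" where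
  "proj_prod M 0 = id"
| "proj_prod M (Suc n) = orth_proj (M (Suc n)) \<circ> proj_prod M n"

definition proj_iter ::
    "(nat \<Rightarrow> 'a::{real_inner, complete_space} set) \<Rightarrow> nat \<Rightarrow> 'a \<Rightarrow> nat \<Rightarrow> 'a" where
  "proj_iter M m y0 k = (proj_prod M m ^^ k) y0"

definition common_part :: "(nat \<Rightarrow> 'a set) \<Rightarrow> nat \<Rightarrow> 'a set" where
  "common_part M m = (\<Inter>i\<in>{1..m}. M i)"

text \<open>Sums of sets are elementwise (\<open>set_sum_alt\<close>, \<open>set_plus_def\<close>); no closure is taken.\<close>

definition perp_sum :: "(nat \<Rightarrow> 'a::real_inner set) \<Rightarrow> nat \<Rightarrow> 'a set" where
  "perp_sum M m = (\<Sum>i=1..m. (M i)\<^sup>\<bottom>)"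

definition good_starts :: "(nat \<Rightarrow> 'a::real_inner set) \<Rightarrow> nat \<Rightarrow> 'a set" where
  "good_starts M m = common_part M m + perp_sum M m"

definition rms_dist :: "(nat \<Rightarrow> 'a::metric_space set) \<Rightarrow> nat \<Rightarrow> 'a \<Rightarrow> real" where
  "rms_dist M m x = sqrt (1 / real m * (\<Sum>i=1..m. (infdist x (M i))\<^sup>2))"

end

theory Submission
  imports Defs
begin

text \<open>
  Write \<open>T\<close> for the product of the projections and measure a point \<open>x\<close> by two quadratic forms:
  the \<^emph>\<open>loss\<close> \<open>S(x) = \<parallel>x\<parallel>\<^sup>2 - \<parallel>T x\<parallel>\<^sup>2\<close> and the \<^emph>\<open>defect\<close>
  \<open>D(x) = \<Sum>\<^sub>i \<parallel>x - P\<^sub>i x\<parallel>\<^sup>2 = \<Sum>\<^sub>i d(x, M\<^sub>i)\<^sup>2\<close>.  By Pythagoras, \<open>S(x)\<close> is the sum of the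
  squared steps that the successive projections make on the way from \<open>x\<close> to \<open>T x\<close>; hence the two
  forms are equivalent (\<open>defect_le_loss\<close>, \<open>loss_le_defect\<close>).

  \<^emph>\<open>Upper bounds.\<close>  Along the same steps one finds the sector condition
  \<open>\<langle>x - T x, y\<rangle>\<^sup>2 \<le> S(x) D(y)\<close> (\<open>sector_bound\<close>).  With \<open>x = T\<^sup>j x\<^sub>0\<close> and
  \<open>y = T\<^sup>j x\<^sub>0 - T\<^sup>j\<^sup>+\<^sup>1 x\<^sub>0\<close> it gives, since \<open>D \<le> m\<^sup>2 S\<close>, that \<open>a\<^sub>j = \<parallel>T\<^sup>j x\<^sub>0 - T\<^sup>j\<^sup>+\<^sup>1 x\<^sub>0\<parallel>\<^sup>2\<close> and
  \<open>E\<^sub>j = \<parallel>T\<^sup>j x\<^sub>0\<parallel>\<^sup>2\<close> satisfy \<open>a\<^sub>j\<^sup>2 \<le> m\<^sup>2 (E\<^sub>j - E\<^sub>j\<^sub>+\<^sub>1) (a\<^sub>j - a\<^sub>j\<^sub>+\<^sub>1)\<close>, and for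
  nonincreasing sequences this recursion forces \<open>n\<^sup>2 a\<^sub>k\<^sub>+\<^sub>n \<le> m\<^sup>2 (E\<^sub>k - E\<^sub>k\<^sub>+\<^sub>n)\<close> (\<open>energy_decay\<close>).  Taking \<open>k\<close> and \<open>n\<close> both
  about half of the index and using that \<open>E\<close> converges, the displacements are \<open>o(1/k)\<close>; since
  \<open>S(y) \<le> 2 \<parallel>y\<parallel> \<parallel>y - T y\<parallel>\<close>, the defects are \<open>o(1/k)\<close> as well.  For starting points in
  \<open>\<Sum>\<^sub>i M\<^sub>i\<^sup>\<bottom>\<close> one argues by duality: the adjoint of \<open>T\<close> is the product of the same projections in
  the reverse order, so by the same bounds, which are uniform on the unit ball,
  \<open>(I - P\<^sub>i) (T\<^sup>*)\<^sup>k\<close> has norm \<open>O(k\<^sup>-\<^sup>1\<^sup>/\<^sup>2)\<close>, hence so has its adjoint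
  \<open>T\<^sup>k (I - P\<^sub>i)\<close>, which is \<open>T\<^sup>k\<close> on \<open>M\<^sub>i\<^sup>\<bottom>\<close> (\<open>iter_perp_sum_bound\<close>).  Feeding this back into the
  estimate for \<open>a\<close> gives the remaining two rates.

  \<^emph>\<open>Optimality.\<close>  Each of the five improved rates implies that \<open>\<Sum>\<^sub>i M\<^sub>i\<^sup>\<bottom>\<close> is closed.  By
  telescoping (\<open>telescoping_tail_bound\<close>) the improved rates for the displacement and for the defect
  on \<open>\<Sum>\<^sub>i M\<^sub>i\<^sup>\<bottom>\<close> give one for \<open>\<parallel>T\<^sup>k x\<parallel>\<close>.  The uniform boundedness principle makes the rates
  uniform; on the whole space, the one for the displacement passes to the defect because of
  \<open>S(y) \<le> 2 \<parallel>y\<parallel> \<parallel>y - T y\<parallel>\<close>.  Duality turns the one for \<open>\<parallel>T\<^sup>k x\<parallel>\<close> on \<open>\<Sum>\<^sub>i M\<^sub>i\<^sup>\<bottom>\<close> into one for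
  \<open>(I - P\<^sub>i) (T\<^sup>*)\<^sup>k\<close>.  So in all cases \<open>S(T\<^sup>k x) \<le> C k\<^sup>-\<^sup>1\<^sup>-\<^sup>\<delta> \<parallel>x\<parallel>\<^sup>2\<close> with some \<open>\<delta> > 0\<close>, for \<open>T\<close> or
  for its adjoint.  Summing over \<open>k\<close> shows that some power \<open>T\<^sup>n\<close> is a strict contraction on the
  closure of \<open>\<Sum>\<^sub>i M\<^sub>i\<^sup>\<bottom>\<close> (\<open>closed_perp_sum_if_residual_decay\<close>).  Then every \<open>x\<close> of the closure is
  \<open>z - T\<^sup>n z\<close> with \<open>z = \<Sum>\<^sub>j T\<^sup>j\<^sup>n x\<close>, and all such differences lie in \<open>\<Sum>\<^sub>i M\<^sub>i\<^sup>\<bottom>\<close> itself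
  (\<open>closed_perp_sum_if_contraction\<close>).
\<close>

section \<open>Orthogonal projections\<close>

lemma orthogonal_compD: "x \<in> L\<^sup>\<bottom> \<Longrightarrow> y \<in> L \<Longrightarrow> x \<bullet> y = 0"
  by (metis (mono_tags) inner_commute mem_Collect_eq orthogonal_comp_def orthogonal_def)

lemma orthogonal_compI: "(\<And>y. y \<in> L \<Longrightarrow> x \<bullet> y = 0) \<Longrightarrow> x \<in> L\<^sup>\<bottom>"
  by (simp add: orthogonal_comp_def orthogonal_def inner_commute)

text \<open>
  A minimizing sequence for the distance to \<open>L\<close> is Cauchy by the parallelogram law, because midpoints
  stay in \<open>L\<close>; the residual of its limit is orthogonal to \<open>L\<close> by the first-order condition.
\<close>
lemma orth_decomposition_exists:
  fixes L :: "'a::{real_inner, complete_space} set"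
  assumes L: "subspace L" "closed L"
  shows "\<exists>p\<in>L. x - p \<in> L\<^sup>\<bottom>"
proof -
  define d where "d = infdist x L"
  have ne: "L \<noteq> {}" and d0: "0 \<le> d"
    using L subspace_0 by (auto simp: d_def infdist_nonneg)
  have d_le: "d\<^sup>2 \<le> (norm (x - z))\<^sup>2" if "z \<in> L" for z
    using infdist_le[OF that, of x] d0 by (simp add: d_def dist_norm power_mono)
  have "\<exists>z\<in>L. (norm (x - z))\<^sup>2 < d\<^sup>2 + 1 / real (Suc n)" for n
  proof -
    have "d < sqrt (d\<^sup>2 + 1 / real (Suc n))"
      using d0 by (intro real_less_rsqrt) auto
    then obtain z where "z \<in> L" "dist x z < sqrt (d\<^sup>2 + 1 / real (Suc n))"
      unfolding d_def infdist_notempty[OF ne] by (subst (asm) cINF_less_iff) (auto simp: ne)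
    then show ?thesis
      by (metis dist_norm norm_ge_zero real_sqrt_abs real_sqrt_less_iff abs_norm_cancel)
  qed
  then obtain z where zL: "\<And>n. z n \<in> L"
    and zd: "\<And>n. (norm (x - z n))\<^sup>2 < d\<^sup>2 + 1 / real (Suc n)"
    by metis
  have near: "(norm (z i - z j))\<^sup>2 \<le> 2 / real (Suc i) + 2 / real (Suc j)" for i j
  proof -
    have mid: "(1/2) *\<^sub>R (z i + z j) \<in> L"
      by (intro subspace_mul subspace_add L zL)
    have "(norm (z i - z j))\<^sup>2 = 2 * (norm (x - z i))\<^sup>2 + 2 * (norm (x - z j))\<^sup>2
        - 4 * (norm (x - (1/2) *\<^sub>R (z i + z j)))\<^sup>2"
      by (simp add: power2_norm_eq_inner algebra_simps inner_commute)
    then show ?thesis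
      using d_le[OF mid] zd[of i] zd[of j] by simp
  qed
  have "Cauchy z"
  proof (rule CauchyI)
    fix e :: real
    assume e: "0 < e"
    obtain N where N: "4 / e\<^sup>2 < real N"
      using reals_Archimedean2 by blast
    have "norm (z i - z j) < e" if "N \<le> i" "N \<le> j" for i j
    proof -
      have "2 / real (Suc i) + 2 / real (Suc j) \<le> 2 / real (Suc N) + 2 / real (Suc N)"
        using that by (intro add_mono divide_left_mono) auto
      also have "\<dots> = 4 / real (Suc N)"
        by simp
      also have "\<dots> < e\<^sup>2"
      proof -
        have "4 < real N * e\<^sup>2" "0 \<le> e\<^sup>2"
          using N e by (simp_all add: field_simps)
        then have "4 < e\<^sup>2 + real N * e\<^sup>2"
          by linarith
        then have "4 < e\<^sup>2 * real (Suc N)"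
          by (simp add: algebra_simps)
        then show ?thesis
          by (simp add: pos_divide_less_eq)
      qed
      finally show ?thesis
        using near[of i j] e by (metis order_le_less_trans power_less_imp_less_base less_imp_le)
    qed
    then show "\<exists>N. \<forall>i\<ge>N. \<forall>j\<ge>N. norm (z i - z j) < e"
      by blast
  qed
  then obtain p where p: "z \<longlonglongrightarrow> p"
    using Cauchy_convergent_iff convergent_def by blast
  have pL: "p \<in> L"
    using closed_sequentially[OF L(2) _ p] zL by blast
  have "(\<lambda>n. (norm (x - z n))\<^sup>2) \<longlonglongrightarrow> (norm (x - p))\<^sup>2"
    by (intro tendsto_intros p)
  moreover have "(\<lambda>n. d\<^sup>2 + 1 / real (Suc n)) \<longlonglongrightarrow> d\<^sup>2 + 0"
    by (intro tendsto_intros LIMSEQ_Suc[OF lim_1_over_n])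
  ultimately have pd: "(norm (x - p))\<^sup>2 \<le> d\<^sup>2"
    using zd less_imp_le by (intro LIMSEQ_le[where Y = "\<lambda>n. d\<^sup>2 + 1 / real (Suc n)"]) auto
  have "(x - p) \<bullet> y = 0" if y: "y \<in> L" for y
  proof (cases "y = 0")
    case False
    \<comment> \<open>\<open>p + t y\<close> is the point nearest to \<open>x\<close> on the line through \<open>p\<close> with direction \<open>y\<close>.\<close>
    define t where "t = ((x - p) \<bullet> y) / (y \<bullet> y)"
    have "p + t *\<^sub>R y \<in> L"
      by (intro subspace_add subspace_mul L pL y)
    from d_le[OF this] pd have "(norm (x - p))\<^sup>2 \<le> (norm ((x - p) - t *\<^sub>R y))\<^sup>2"
      unfolding diff_diff_eq by linarith
    also have "\<dots> = (norm (x - p))\<^sup>2 - 2 * t * ((x - p) \<bullet> y) + t\<^sup>2 * (y \<bullet> y)"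
      by (simp only: power2_norm_eq_inner)
        (simp add: inner_diff_left inner_diff_right inner_commute algebra_simps power2_eq_square)
    also have "\<dots> = (norm (x - p))\<^sup>2 - ((x - p) \<bullet> y)\<^sup>2 / (y \<bullet> y)"
      using False by (simp add: t_def field_simps power2_eq_square)
    finally have "((x - p) \<bullet> y)\<^sup>2 / (y \<bullet> y) \<le> 0"
      by simp
    moreover have "0 < y \<bullet> y"
      using False by simp
    ultimately show ?thesis
      by (simp add: divide_le_0_iff)
  qed simp
  then show ?thesis
    using pL by (intro bexI[of _ p] orthogonal_compI) auto
qed

lemma orth_proj_eqI:
  fixes L :: "'a::{real_inner, complete_space} set"
  assumes L: "subspace L" and p: "p \<in> L" "x - p \<in> L\<^sup>\<bottom>"
  shows "orth_proj L x = p"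
  unfolding orth_proj_def
proof (rule the_equality)
  fix q
  assume q: "q \<in> L \<and> x - q \<in> L\<^sup>\<bottom>"
  have "p - q \<in> L"
    using L p q by (simp add: subspace_diff)
  then have "(p - q) \<bullet> (p - q) = (x - q) \<bullet> (p - q) - (x - p) \<bullet> (p - q)"
    by (simp add: inner_diff_left)
  also have "\<dots> = 0"
    using orthogonal_compD[OF _ \<open>p - q \<in> L\<close>] p q by simp
  finally show "q = p"
    by simp
qed (use p in blast)

context
  fixes L :: "'a::{real_inner, complete_space} set"
  assumes L: "subspace L" "closed L"
begin

lemma orth_proj_mem: "orth_proj L x \<in> L"
  and orth_proj_residual: "x - orth_proj L x \<in> L\<^sup>\<bottom>"
proof -
  obtain p where "p \<in> L" "x - p \<in> L\<^sup>\<bottom>"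
    using orth_decomposition_exists[OF L] by blast
  then show "orth_proj L x \<in> L" "x - orth_proj L x \<in> L\<^sup>\<bottom>"
    using orth_proj_eqI[OF L(1)] by auto
qed

lemma orth_proj_fix: "x \<in> L \<Longrightarrow> orth_proj L x = x"
  by (rule orth_proj_eqI[OF L(1)]) (auto intro: orthogonal_compI)

lemma orth_proj_perp: "x \<in> L\<^sup>\<bottom> \<Longrightarrow> orth_proj L x = 0"
  by (rule orth_proj_eqI[OF L(1)]) (auto simp: subspace_0 L)

lemma inner_residual: "y \<in> L \<Longrightarrow> (x - orth_proj L x) \<bullet> y = 0"
  using orth_proj_residual orthogonal_compD by blast

lemma orth_proj_adjoint: "orth_proj L x \<bullet> y = x \<bullet> orth_proj L y"
proof -
  have "(x - orth_proj L x) \<bullet> orth_proj L y = 0" "(y - orth_proj L y) \<bullet> orth_proj L x = 0"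
    by (intro inner_residual orth_proj_mem)+
  then show ?thesis
    by (simp add: inner_diff_left inner_diff_right inner_commute)
qed

lemma orth_proj_pythagoras:
  "(norm x)\<^sup>2 = (norm (orth_proj L x))\<^sup>2 + (norm (x - orth_proj L x))\<^sup>2"
proof -
  have "(x - orth_proj L x) \<bullet> orth_proj L x = 0"
    by (intro inner_residual orth_proj_mem)
  then show ?thesis
    by (simp add: power2_norm_eq_inner inner_diff_left inner_diff_right inner_commute)
qed

lemma norm_orth_proj_le: "norm (orth_proj L x) \<le> norm x"
  by (rule power2_le_imp_le) (simp_all add: orth_proj_pythagoras[of x])

lemma norm_residual_le: "y \<in> L \<Longrightarrow> norm (x - orth_proj L x) \<le> norm (x - y)"
proof (rule power2_le_imp_le)
  assume y: "y \<in> L"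
  have "(x - orth_proj L x) \<bullet> (orth_proj L x - y) = 0"
    by (intro inner_residual subspace_diff L orth_proj_mem y)
  then have "(norm (x - y))\<^sup>2 = (norm (x - orth_proj L x))\<^sup>2 + (norm (orth_proj L x - y))\<^sup>2"
    by (simp add: power2_norm_eq_inner inner_diff_left inner_diff_right inner_commute)
  then show "(norm (x - orth_proj L x))\<^sup>2 \<le> (norm (x - y))\<^sup>2"
    by simp
qed simp

lemma infdist_eq_norm_residual: "infdist x L = norm (x - orth_proj L x)"
proof (rule antisym)
  show "infdist x L \<le> norm (x - orth_proj L x)"
    using infdist_le[OF orth_proj_mem] by (simp add: dist_norm)
  have "L \<noteq> {}"
    using orth_proj_mem by blast
  then show "norm (x - orth_proj L x) \<le> infdist x L"
    unfolding infdist_notempty[OF \<open>L \<noteq> {}\<close>]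
    by (intro cINF_greatest) (auto simp: dist_norm norm_residual_le)
qed

lemma bounded_linear_orth_proj: "bounded_linear (orth_proj L)"
proof (rule bounded_linear_intro[where K = 1])
  fix x y and r :: real
  show "orth_proj L (x + y) = orth_proj L x + orth_proj L y"
  proof (rule orth_proj_eqI[OF L(1)])
    have "(x - orth_proj L x) + (y - orth_proj L y) \<in> L\<^sup>\<bottom>"
      by (intro subspace_add subspace_orthogonal_comp orth_proj_residual)
    then show "x + y - (orth_proj L x + orth_proj L y) \<in> L\<^sup>\<bottom>"
      by (simp add: algebra_simps)
  qed (intro subspace_add L orth_proj_mem)
  show "orth_proj L (r *\<^sub>R x) = r *\<^sub>R orth_proj L x"
  proof (rule orth_proj_eqI[OF L(1)])
    have "r *\<^sub>R (x - orth_proj L x) \<in> L\<^sup>\<bottom>"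
      by (intro subspace_mul subspace_orthogonal_comp orth_proj_residual)
    then show "r *\<^sub>R x - r *\<^sub>R orth_proj L x \<in> L\<^sup>\<bottom>"
      by (simp add: algebra_simps)
  qed (intro subspace_mul L orth_proj_mem)
qed (simp add: norm_orth_proj_le)

end

section \<open>Uniform boundedness and adjoint norms\<close>

text \<open>
  The Banach--Steinhaus theorem for a sequence of operators.  By Baire, one of the closed sets on which
  all \<open>F k\<close> are bounded by \<open>n\<close> contains a ball, and the difference of two points of that ball reaches
  every direction.
\<close>
lemma uniform_boundedness:
  fixes F :: "nat \<Rightarrow> 'a::{real_normed_vector, complete_space} \<Rightarrow> 'b::real_normed_vector"
  assumes F: "\<And>k. bounded_linear (F k)" and pw: "\<And>x. \<exists>c. \<forall>k. norm (F k x) \<le> c"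
  shows "\<exists>C\<ge>0. \<forall>k x. norm (F k x) \<le> C * norm x"
proof -
  define A where "A n = {x. \<forall>k. norm (F k x) \<le> real n}" for n
  have closed: "closed (A n)" for n
  proof -
    have "A n = (\<Inter>k. {x. norm (F k x) \<le> real n})"
      by (auto simp: A_def)
    moreover have "closed {x. norm (F k x) \<le> real n}" for k
      by (intro closed_Collect_le continuous_intros linear_continuous_on F)
    ultimately show ?thesis
      by auto
  qed
  have "x \<in> \<Union> (range A)" for x
  proof -
    obtain c where c: "\<forall>k. norm (F k x) \<le> c"
      using pw by blast
    obtain n where "c \<le> real n"
      using real_arch_simple by blast
    then have "x \<in> A n"
      using c by (auto simp: A_def intro: order_trans)
    then show ?thesis
      by blast
  qed
  then have cover: "\<Union> (range A) = UNIV"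
    by blast
  have "\<exists>n. interior (A n) \<noteq> {}"
  proof (rule ccontr)
    assume "\<not> ?thesis"
    then have "(euclidean :: 'a topology) interior_of \<Union> (range A) = {}"
      using closed
      by (intro Baire_category_alt) (auto simp: completely_metrizable_space_euclidean)
    then show False
      by (simp add: cover)
  qed
  then obtain n a where "a \<in> interior (A n)"
    by blast
  then obtain r where r: "r > 0" "cball a r \<subseteq> A n"
    by (meson mem_interior_cball)
  have "norm (F k x) \<le> (2 * real n / r) * norm x" for k x
  proof (cases "x = 0")
    case True
    then show ?thesis
      by (simp add: linear_simps[OF F])
  next
    case False
    define s where "s = r / norm x"
    have s: "s > 0"
      using False r by (simp add: s_def)
    have "a + s *\<^sub>R x \<in> cball a r" "a \<in> cball a r"
      using False r by (auto simp: s_def dist_norm)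
    then have "a + s *\<^sub>R x \<in> A n" "a \<in> A n"
      using r(2) by blast+
    then have "norm (F k (a + s *\<^sub>R x)) \<le> real n" "norm (F k a) \<le> real n"
      by (simp_all add: A_def)
    moreover have "s *\<^sub>R F k x = F k (a + s *\<^sub>R x) - F k a"
      by (simp add: linear_simps[OF F])
    ultimately have "norm (s *\<^sub>R F k x) \<le> 2 * real n"
      using norm_triangle_ineq4[of "F k (a + s *\<^sub>R x)" "F k a"] by simp
    then show ?thesis
      using s r False by (simp add: s_def field_simps)
  qed
  then show ?thesis
    using r by (intro exI[of _ "2 * real n / r"]) auto
qed

text \<open>
  Used to move a norm bound between \<open>T\<^sup>k (I - P\<^sub>i)\<close> and \<open>(I - P\<^sub>i) (T\<^sup>*)\<^sup>k\<close>.
\<close>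
lemma adjoint_norm_le:
  fixes A B :: "'a::real_inner \<Rightarrow> 'a"
  assumes adj: "\<And>x y. A x \<bullet> y = x \<bullet> B y" and bound: "\<And>x. norm (A x) \<le> c * norm x"
  shows "norm (B y) \<le> c * norm y"
proof (cases "B y = 0")
  case True
  have "0 \<le> c * norm y"
    using bound[of y] norm_ge_zero order_trans by blast
  then show ?thesis
    by (simp add: True)
next
  case False
  have "norm (B y) * norm (B y) = A (B y) \<bullet> y"
    by (simp add: adj power2_norm_eq_inner flip: power2_eq_square)
  also have "\<dots> \<le> norm (A (B y)) * norm y"
    by (rule norm_cauchy_schwarz)
  also have "\<dots> \<le> (c * norm (B y)) * norm y"
    by (intro mult_right_mono bound) simp
  finally show ?thesis
    using False by (simp add: mult.assoc mult.commute mult.left_commute)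
qed

section \<open>Decay of real sequences\<close>

text \<open>
  Dividing the hypothesis by \<open>a\<^sub>j a\<^sub>j\<^sub>+\<^sub>1 \<le> a\<^sub>j\<^sup>2\<close> gives
  \<open>1 \<le> C (E\<^sub>j - E\<^sub>j\<^sub>+\<^sub>1) (1/a\<^sub>j\<^sub>+\<^sub>1 - 1/a\<^sub>j)\<close>.  Summing the square roots of the right-hand sides
  over \<open>n\<close> consecutive indices yields at least \<open>n\<close>, whereas by Cauchy--Schwarz the sum is at most the
  square root of a product of two telescoping sums, the second of which is below \<open>1/a\<^sub>k\<^sub>+\<^sub>n\<close>.
\<close>
lemma energy_decay:
  fixes a E :: "nat \<Rightarrow> real"
  assumes a: "\<And>j. 0 \<le> a j" "\<And>j. a (Suc j) \<le> a j" and E: "\<And>j. E (Suc j) \<le> E j" and C: "0 \<le> C"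
    and step: "\<And>j. (a j)\<^sup>2 \<le> C * (E j - E (Suc j)) * (a j - a (Suc j))"
  shows "(real n)\<^sup>2 * a (k + n) \<le> C * (E k - E (k + n))"
proof (cases "a (k + n) = 0")
  case True
  then show ?thesis
    using lift_Suc_antimono_le[of E, OF E, of k "k + n"] C by simp
next
  case False
  have pos: "0 < a (k + j)" if "j \<le> n" for j
    using lift_Suc_antimono_le[of a, OF a(2), of "k + j" "k + n"] that False a(1)[of "k + n"] by simp
  define S where "S j = C * (E (k + j) - E (k + Suc j))" for j
  define B where "B j = 1 / a (k + Suc j) - 1 / a (k + j)" for j
  have one: "1 \<le> sqrt (S j) * sqrt (B j)" if "j < n" for j
  proof -
    let ?p = "a (k + j)" and ?q = "a (k + Suc j)"
    have p: "0 < ?p" "0 < ?q" "?q \<le> ?p"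
      using pos[of j] pos[of "Suc j"] that a(2)[of "k + j"] by auto
    have "S j \<ge> 0"
      using C E[of "k + j"] by (simp add: S_def)
    have "?q * ?p \<le> ?p\<^sup>2"
      using p by (simp add: power2_eq_square)
    also have "\<dots> \<le> S j * (?p - ?q)"
      using step[of "k + j"] by (simp add: S_def)
    finally have "1 \<le> S j * ((?p - ?q) / (?q * ?p))"
      using p by (simp add: field_simps)
    also have "(?p - ?q) / (?q * ?p) = B j"
      using p by (simp add: B_def field_simps)
    finally show ?thesis
      by (simp flip: real_sqrt_mult)
  qed
  have S0: "0 \<le> S j" for j
    using C E[of "k + j"] by (simp add: S_def)
  have B0: "0 \<le> B j" if "j < n" for j
    using pos[of j] pos[of "Suc j"] that a(2)[of "k + j"] by (simp add: B_def frac_le)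
  have "real n = (\<Sum>j<n. 1)"
    by simp
  also have "\<dots> \<le> (\<Sum>j<n. sqrt (S j) * sqrt (B j))"
    using one by (intro sum_mono) auto
  finally have "(real n)\<^sup>2 \<le> (\<Sum>j<n. sqrt (S j) * sqrt (B j))\<^sup>2"
    by (intro power_mono) auto
  also have "\<dots> \<le> (\<Sum>j<n. (sqrt (S j))\<^sup>2) * (\<Sum>j<n. (sqrt (B j))\<^sup>2)"
    by (rule Cauchy_Schwarz_ineq_sum)
  also have "\<dots> = (\<Sum>j<n. S j) * (\<Sum>j<n. B j)"
    using S0 B0 by simp
  also have "(\<Sum>j<n. S j) = C * (E k - E (k + n))"
    using sum_lessThan_telescope'[of "\<lambda>j. E (k + j)" n] by (simp add: S_def flip: sum_distrib_left)
  also have "(\<Sum>j<n. B j) = 1 / a (k + n) - 1 / a k"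
    using sum_lessThan_telescope[of "\<lambda>j. 1 / a (k + j)" n] by (simp add: B_def)
  also have "C * (E k - E (k + n)) * (1 / a (k + n) - 1 / a k) \<le> C * (E k - E (k + n)) * (1 / a (k + n))"
    using C lift_Suc_antimono_le[of E, OF E, of k "k + n"] a(1) by (intro mult_left_mono) auto
  finally show ?thesis
    using pos[of n] by (simp add: field_simps)
qed

text \<open>
  The drops of \<open>f\<close> beyond \<open>n\<close> add up to \<open>f n\<close>, so this bounds a tail of the series of
  \<open>k\<^sup>-\<^sup>1\<^sup>-\<^sup>\<delta>\<close>.  Instead of summing, compare \<open>f\<close> with a multiple of \<open>k\<^sup>-\<^sup>\<delta>\<close>: by the mean value
  theorem the latter drops at least as fast, so the difference \<open>g\<close> is increasing; as it tends
  to \<open>0\<close>, it is never positive.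
\<close>
lemma telescoping_tail_bound:
  fixes f :: "nat \<Rightarrow> real"
  assumes \<delta>: "0 < \<delta>" and K: "0 \<le> K" and f: "f \<longlonglongrightarrow> 0"
    and drop: "\<And>k. 1 \<le> k \<Longrightarrow> f k - f (Suc k) \<le> K * real k powr (-1 - \<delta>)"
    and n: "1 \<le> n"
  shows "f n \<le> K * (2 powr (1 + \<delta>) / \<delta>) * real n powr (-\<delta>)"
proof -
  define C where "C = 2 powr (1 + \<delta>) / \<delta>"
  have gap: "real k powr (-1 - \<delta>) \<le> C * (real k powr (-\<delta>) - real (Suc k) powr (-\<delta>))" if k: "1 \<le> k" for k
  proof -
    have "\<exists>z. real k < z \<and> z < real (Suc k) \<and>
        real (Suc k) powr (-\<delta>) - real k powr (-\<delta>) = (real (Suc k) - real k) * (-\<delta> * z powr (-\<delta> - 1))"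
    proof (rule MVT2)
      fix x
      assume "real k \<le> x"
      then have "0 < x"
        using k by simp
      then show "((\<lambda>x. x powr (-\<delta>)) has_real_derivative -\<delta> * x powr (-\<delta> - 1)) (at x)"
        by (rule has_real_derivative_powr)
    qed simp
    then obtain z where z: "real k < z" "z < real (Suc k)"
      "real k powr (-\<delta>) - real (Suc k) powr (-\<delta>) = \<delta> * z powr (-\<delta> - 1)"
      by auto
    have "2 powr (1 + \<delta>) * 2 powr (-\<delta> - 1) = (1::real)"
      by (simp flip: powr_add)
    moreover have "-1 - \<delta> = -\<delta> - 1"
      by simp
    ultimately have "real k powr (-1 - \<delta>) = 2 powr (1 + \<delta>) * (2 * real k) powr (-\<delta> - 1)"
      by (simp only: powr_mult mult.assoc[symmetric] mult_1)
    \<comment> \<open>The intermediate point satisfies \<open>z < k + 1 \<le> 2 k\<close>, whence the power of \<open>2\<close> in the constant.\<close>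
    also have "(2 * real k) powr (-\<delta> - 1) \<le> z powr (-\<delta> - 1)"
      using \<delta> k z by (intro powr_mono2') auto
    finally have "real k powr (-1 - \<delta>) \<le> 2 powr (1 + \<delta>) * z powr (-\<delta> - 1)"
      by simp
    also have "\<dots> = C * (real k powr (-\<delta>) - real (Suc k) powr (-\<delta>))"
      unfolding z(3) using \<delta> by (simp add: C_def)
    finally show ?thesis .
  qed
  define g where "g k = f k - K * C * real k powr (-\<delta>)" for k
  have g_mono: "g k \<le> g (Suc k)" if "1 \<le> k" for k
    using mult_left_mono[OF gap[OF that] K] drop[OF that] by (simp add: g_def algebra_simps)
  have "(\<lambda>k. real k powr (-\<delta>)) \<longlonglongrightarrow> 0"
    using \<delta> by (intro tendsto_neg_powr filterlim_real_sequentially) auto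
  then have "g \<longlonglongrightarrow> 0 - K * C * 0"
    unfolding g_def by (intro tendsto_intros f)
  moreover have "g n \<le> g k" if "n \<le> k" for k
    using that
  proof (induction k rule: dec_induct)
    case (step k)
    then show ?case
      using g_mono[of k] n by simp
  qed simp
  ultimately have "g n \<le> 0"
    by (intro LIMSEQ_le_const[where X = g]) auto
  then show ?thesis
    by (simp add: g_def C_def mult.assoc)
qed

section \<open>The cyclic product of projections\<close>

locale closed_subspaces =
  fixes M :: "nat \<Rightarrow> 'a::{real_inner, complete_space} set" and m :: nat
  assumes subspace_M: "i \<in> {1..m} \<Longrightarrow> subspace (M i)"
    and closed_M: "i \<in> {1..m} \<Longrightarrow> closed (M i)"
begin

abbreviation "T \<equiv> proj_prod M m"

abbreviation "residual i x \<equiv> x - orth_proj (M i) x"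

text \<open>
  Up to the factor \<open>m\<close>, the square of \<open>rms_dist\<close>; see \<open>rms_dist_eq\<close>.
\<close>
definition defect :: "'a \<Rightarrow> real" where
  "defect x = (\<Sum>i<m. (norm (residual (Suc i) x))\<^sup>2)"

definition loss :: "'a \<Rightarrow> real" where
  "loss x = (norm x)\<^sup>2 - (norm (T x))\<^sup>2"

lemma M_Suc: "i < m \<Longrightarrow> subspace (M (Suc i))" "i < m \<Longrightarrow> closed (M (Suc i))"
  using subspace_M closed_M by auto

lemma rms_dist_eq: "rms_dist M m x = sqrt (1 / real m) * sqrt (defect x)"
proof -
  have "(\<Sum>i=1..m. (infdist x (M i))\<^sup>2) = defect x"
    unfolding defect_def
    by (simp add: sum.atLeast1_atMost_eq infdist_eq_norm_residual M_Suc)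
  then show ?thesis
    by (simp only: rms_dist_def real_sqrt_mult)
qed

lemma bounded_linear_prod: "n \<le> m \<Longrightarrow> bounded_linear (proj_prod M n)"
proof (induction n)
  case 0
  then show ?case
    by (simp add: id_def bounded_linear_ident)
next
  case (Suc n)
  then have "bounded_linear (orth_proj (M (Suc n)))"
    by (intro bounded_linear_orth_proj M_Suc) auto
  with Suc show ?case
    using bounded_linear_compose[of "orth_proj (M (Suc n))" "proj_prod M n"] by (simp add: o_def)
qed

lemma bounded_linear_T: "bounded_linear T"
  by (rule bounded_linear_prod) simp

lemma bounded_linear_iter: "bounded_linear (T ^^ k)"
proof (induction k)
  case 0
  then show ?case
    by (simp add: id_def bounded_linear_ident)
next
  case (Suc k)
  then show ?case
    using bounded_linear_compose[OF bounded_linear_T, of "T ^^ k"] by (simp add: o_def)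
qed

lemma prod_pythagoras:
  "n \<le> m \<Longrightarrow> (norm x)\<^sup>2 = (norm (proj_prod M n x))\<^sup>2
      + (\<Sum>i<n. (norm (residual (Suc i) (proj_prod M i x)))\<^sup>2)"
proof (induction n)
  case (Suc n)
  then show ?case
    using orth_proj_pythagoras[OF M_Suc, of n "proj_prod M n x"] by simp
qed simp

lemma loss_eq: "loss x = (\<Sum>i<m. (norm (residual (Suc i) (proj_prod M i x)))\<^sup>2)"
  using prod_pythagoras[of m x] by (simp add: loss_def)

lemma loss_nonneg: "0 \<le> loss x"
  unfolding loss_eq by (intro sum_nonneg) simp

lemma defect_nonneg: "0 \<le> defect x"
  unfolding defect_def by (intro sum_nonneg) simp

lemma norm_T_le: "norm (T x) \<le> norm x"
  by (rule power2_le_imp_le) (use loss_nonneg[of x] in \<open>simp_all add: loss_def\<close>)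

lemma norm_iter_le: "norm ((T ^^ k) x) \<le> norm x"
proof (induction k)
  case (Suc k)
  then show ?case
    using norm_T_le[of "(T ^^ k) x"] by simp
qed simp

lemma norm_iter_antimono: "j \<le> k \<Longrightarrow> norm ((T ^^ k) x) \<le> norm ((T ^^ j) x)"
  by (rule lift_Suc_antimono_le[of "\<lambda>k. norm ((T ^^ k) x)"]) (simp add: norm_T_le)

text \<open>
  After the step with index \<open>i\<close> the point lies in \<open>M\<^sub>i\<close>, so the distance from \<open>x\<close> to \<open>M\<^sub>i\<close> is at most
  the length of the path travelled up to then.
\<close>
lemma defect_le_loss: "defect x \<le> (real m)\<^sup>2 * loss x"
proof -
  let ?s = "\<lambda>i. norm (residual (Suc i) (proj_prod M i x))"
  have walk: "norm (x - proj_prod M n x) \<le> (\<Sum>i<n. ?s i)" for n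
  proof (induction n)
    case (Suc n)
    have "x - proj_prod M (Suc n) x = (x - proj_prod M n x) + residual (Suc n) (proj_prod M n x)"
      by simp
    then have "norm (x - proj_prod M (Suc n) x) \<le> norm (x - proj_prod M n x) + ?s n"
      using norm_triangle_ineq by metis
    then show ?case
      using Suc by simp
  qed simp
  have "(norm (residual (Suc n) x))\<^sup>2 \<le> real m * loss x" if n: "n < m" for n
  proof -
    have "norm (residual (Suc n) x) \<le> norm (x - proj_prod M (Suc n) x)"
      using n by (intro norm_residual_le M_Suc) (auto simp: orth_proj_mem M_Suc)
    also have "\<dots> \<le> (\<Sum>i<Suc n. ?s i)"
      by (rule walk)
    also have "\<dots> \<le> (\<Sum>i<m. ?s i)"
      using n by (intro sum_mono2) auto
    finally have "(norm (residual (Suc n) x))\<^sup>2 \<le> (\<Sum>i<m. ?s i)\<^sup>2"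
      by (intro power_mono) auto
    also have "\<dots> \<le> (\<Sum>i<m. (?s i)\<^sup>2) * real (card {..<m})"
      by (rule sum_squared_le_sum_of_squares)
    finally show ?thesis
      by (simp add: loss_eq mult.commute)
  qed
  then have "defect x \<le> (\<Sum>i<m. real m * loss x)"
    unfolding defect_def by (intro sum_mono) auto
  then show ?thesis
    by (simp add: power2_eq_square mult.assoc)
qed

text \<open>
  As projections are nonexpansive, the partial products of \<open>x\<close> stray from \<open>x\<close> by at most the sum of
  the distances from \<open>x\<close> to the subspaces; so every single step is at most that long.
\<close>
lemma loss_le_defect: "loss x \<le> (real m)\<^sup>2 * defect x"
proof -
  let ?r = "\<lambda>i. norm (residual (Suc i) x)"
  have drift: "norm (proj_prod M n x - x) \<le> (\<Sum>i<n. ?r i)" if "n \<le> m" for n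
    using that
  proof (induction n)
    case (Suc n)
    let ?P = "orth_proj (M (Suc n))"
    have lin: "bounded_linear ?P"
      using Suc.prems by (intro bounded_linear_orth_proj M_Suc) auto
    have "proj_prod M (Suc n) x - x = ?P (proj_prod M n x - x) - residual (Suc n) x"
      by (simp add: linear_simps[OF lin])
    then have "norm (proj_prod M (Suc n) x - x) \<le> norm (?P (proj_prod M n x - x)) + ?r n"
      using norm_triangle_ineq4 by metis
    also have "norm (?P (proj_prod M n x - x)) \<le> norm (proj_prod M n x - x)"
      using Suc.prems by (intro norm_orth_proj_le M_Suc) auto
    finally show ?case
      using Suc by simp
  qed simp
  have "(norm (residual (Suc n) (proj_prod M n x)))\<^sup>2 \<le> real m * defect x" if n: "n < m" for n
  proof -
    have "norm (residual (Suc n) (proj_prod M n x)) \<le> norm (proj_prod M n x - orth_proj (M (Suc n)) x)"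
      using n by (intro norm_residual_le M_Suc orth_proj_mem) auto
    also have "\<dots> \<le> norm (proj_prod M n x - x) + ?r n"
      using norm_triangle_ineq[of "proj_prod M n x - x" "residual (Suc n) x"] by simp
    also have "\<dots> \<le> (\<Sum>i<Suc n. ?r i)"
      using drift[of n] n by simp
    also have "\<dots> \<le> (\<Sum>i<m. ?r i)"
      using n by (intro sum_mono2) auto
    finally have "(norm (residual (Suc n) (proj_prod M n x)))\<^sup>2 \<le> (\<Sum>i<m. ?r i)\<^sup>2"
      by (intro power_mono) auto
    also have "\<dots> \<le> (\<Sum>i<m. (?r i)\<^sup>2) * real (card {..<m})"
      by (rule sum_squared_le_sum_of_squares)
    finally show ?thesis
      by (simp add: defect_def mult.commute)
  qed
  then have "loss x \<le> (\<Sum>i<m. real m * defect x)"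
    unfolding loss_eq by (intro sum_mono) auto
  then show ?thesis
    by (simp add: power2_eq_square mult.assoc)
qed

lemma displacement_eq: "x - T x = (\<Sum>i<m. residual (Suc i) (proj_prod M i x))"
  using sum_lessThan_telescope'[of "\<lambda>i. proj_prod M i x" m] by simp

text \<open>
  This is the real counterpart of the fact that the numerical range of \<open>T\<close> lies in a sector with
  vertex \<open>1\<close>.  Each step from \<open>x\<close> to \<open>T x\<close> is orthogonal to the subspace onto which it projects, so
  it only sees the component of \<open>y\<close> orthogonal to that subspace.
\<close>
lemma sector_bound: "((x - T x) \<bullet> y)\<^sup>2 \<le> loss x * defect y"
proof -
  let ?a = "\<lambda>i. residual (Suc i) (proj_prod M i x)" and ?b = "\<lambda>i. residual (Suc i) y"
  have "?a i \<bullet> y = ?a i \<bullet> ?b i" if "i < m" for i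
  proof -
    have "?a i \<bullet> orth_proj (M (Suc i)) y = 0"
      using that by (intro inner_residual M_Suc orth_proj_mem) auto
    then show ?thesis
      by (simp add: inner_diff_right)
  qed
  then have "(x - T x) \<bullet> y = (\<Sum>i<m. ?a i \<bullet> ?b i)"
    by (simp add: displacement_eq inner_sum_left)
  then have "\<bar>(x - T x) \<bullet> y\<bar> \<le> (\<Sum>i<m. norm (?a i) * norm (?b i))"
    by (auto intro!: order_trans[OF sum_abs] sum_mono Cauchy_Schwarz_ineq2)
  then have "((x - T x) \<bullet> y)\<^sup>2 \<le> (\<Sum>i<m. norm (?a i) * norm (?b i))\<^sup>2"
    using power_mono[of "\<bar>(x - T x) \<bullet> y\<bar>" _ 2] by simp
  also have "\<dots> \<le> loss x * defect y"
    unfolding loss_eq defect_def by (rule Cauchy_Schwarz_ineq_sum)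
  finally show ?thesis .
qed

text \<open>
  The displacement \<open>d = y - T y\<close> of an iterate \<open>y\<close> is its own test vector in the sector bound:
  \<open>\<parallel>d\<parallel>\<^sup>4 = \<langle>y - T y, d\<rangle>\<^sup>2 \<le> S(y) D(d) \<le> m\<^sup>2 S(y) S(d)\<close>, and the two losses are consecutive
  differences of \<open>\<parallel>y\<parallel>\<^sup>2\<close> and of \<open>\<parallel>d\<parallel>\<^sup>2\<close> along the iteration.
\<close>
lemma displacement_decay:
  "(real n)\<^sup>2 * (norm ((T ^^ (k + n)) x - (T ^^ Suc (k + n)) x))\<^sup>2
    \<le> (real m)\<^sup>2 * ((norm ((T ^^ k) x))\<^sup>2 - (norm ((T ^^ (k + n)) x))\<^sup>2)"
proof (rule energy_decay[where a = "\<lambda>j. (norm ((T ^^ j) x - (T ^^ Suc j) x))\<^sup>2"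
      and E = "\<lambda>j. (norm ((T ^^ j) x))\<^sup>2"])
  fix j
  let ?y = "(T ^^ j) x"
  let ?d = "?y - (T ^^ Suc j) x"
  have next_d: "(T ^^ Suc j) x - (T ^^ Suc (Suc j)) x = T ?d"
    by (simp add: linear_simps[OF bounded_linear_T])
  show "(norm ((T ^^ Suc j) x - (T ^^ Suc (Suc j)) x))\<^sup>2 \<le> (norm ?d)\<^sup>2"
    unfolding next_d by (intro power_mono norm_T_le) simp
  show "(norm ((T ^^ Suc j) x))\<^sup>2 \<le> (norm ?y)\<^sup>2"
    by (intro power_mono) (simp_all add: norm_T_le)
  have "((norm ?d)\<^sup>2)\<^sup>2 = ((?y - T ?y) \<bullet> ?d)\<^sup>2"
    by (simp add: power2_norm_eq_inner)
  also have "\<dots> \<le> loss ?y * defect ?d"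
    by (rule sector_bound)
  also have "\<dots> \<le> loss ?y * ((real m)\<^sup>2 * loss ?d)"
    by (intro mult_left_mono defect_le_loss loss_nonneg)
  also have "\<dots> = (real m)\<^sup>2 * ((norm ?y)\<^sup>2 - (norm ((T ^^ Suc j) x))\<^sup>2)
      * ((norm ?d)\<^sup>2 - (norm ((T ^^ Suc j) x - (T ^^ Suc (Suc j)) x))\<^sup>2)"
    unfolding next_d by (simp add: loss_def)
  finally show "((norm ?d)\<^sup>2)\<^sup>2 \<le> \<dots>" .
qed simp_all

text \<open>
  The previous lemma applied to the second half of the first \<open>k\<close> iterates; from \<open>k = 4\<close> on that half
  contains at least \<open>k / 4\<close> of them.
\<close>
lemma displacement_bound:
  assumes k: "4 \<le> k"
  shows "real k * norm ((T ^^ k) x - (T ^^ (k - 1)) x)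
    \<le> 4 * real m * sqrt ((norm ((T ^^ (k div 2)) x))\<^sup>2 - (norm ((T ^^ k) x))\<^sup>2)"
proof (rule power2_le_imp_le)
  define n where "n = k - 1 - k div 2"
  have n: "k \<le> 4 * n" "k div 2 + n = k - 1" "Suc (k - 1) = k"
    using k by (auto simp: n_def)
  let ?d = "norm ((T ^^ k) x - (T ^^ (k - 1)) x)"
  let ?E = "\<lambda>j. (norm ((T ^^ j) x))\<^sup>2"
  have E: "?E k \<le> ?E (k - 1)" "?E k \<le> ?E (k div 2)"
    by (intro power_mono norm_iter_antimono; simp)+
  have "(real k * ?d)\<^sup>2 \<le> (4 * real n * ?d)\<^sup>2"
    using n(1) by (intro power_mono mult_right_mono) auto
  also have "\<dots> = 16 * ((real n)\<^sup>2 * ?d\<^sup>2)"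
    by (simp add: power_mult_distrib)
  also have "(real n)\<^sup>2 * ?d\<^sup>2 \<le> (real m)\<^sup>2 * (?E (k div 2) - ?E (k - 1))"
    using displacement_decay[of n "k div 2" x] 
    by (simp only: n norm_minus_commute[of "(T ^^ (k - 1)) x"])
  also have "\<dots> \<le> (real m)\<^sup>2 * (?E (k div 2) - ?E k)"
    using E by (intro mult_left_mono) auto
  finally show "(real k * ?d)\<^sup>2 \<le> (4 * real m * sqrt (?E (k div 2) - ?E k))\<^sup>2"
    using E by (simp add: power_mult_distrib)
qed (use k in \<open>auto intro!: mult_nonneg_nonneg power_mono norm_iter_antimono\<close>)

lemma loss_iter_le:
  "loss ((T ^^ k) x) \<le> 2 * norm ((T ^^ k) x) * norm ((T ^^ Suc k) x - (T ^^ k) x)"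
proof -
  let ?p = "norm ((T ^^ k) x)" and ?q = "norm ((T ^^ Suc k) x)"
  have "loss ((T ^^ k) x) = (?p + ?q) * (?p - ?q)"
    by (simp add: loss_def power2_eq_square algebra_simps)
  also have "\<dots> \<le> (2 * ?p) * norm ((T ^^ Suc k) x - (T ^^ k) x)"
    using norm_triangle_ineq2[of "(T ^^ k) x" "(T ^^ Suc k) x"] norm_T_le[of "(T ^^ k) x"]
    by (intro mult_mono) (auto simp: norm_minus_commute)
  finally show ?thesis .
qed

lemma loss_iter_bound:
  assumes k: "3 \<le> k"
  shows "real k * loss ((T ^^ k) x) \<le> 8 * real m * (norm x)\<^sup>2"
proof -
  let ?d = "norm ((T ^^ Suc k) x - (T ^^ k) x)"
  have "real k * ?d \<le> real (Suc k) * ?d"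
    by (intro mult_right_mono) auto
  also have "\<dots> \<le> 4 * real m * sqrt ((norm ((T ^^ (Suc k div 2)) x))\<^sup>2 - (norm ((T ^^ Suc k) x))\<^sup>2)"
    using displacement_bound[of "Suc k" x] k by simp
  also have "\<dots> \<le> 4 * real m * sqrt ((norm x)\<^sup>2)"
  proof (intro mult_left_mono real_sqrt_le_mono)
    have "(norm ((T ^^ (Suc k div 2)) x))\<^sup>2 \<le> (norm x)\<^sup>2"
      by (intro power_mono norm_iter_le) simp
    moreover have "0 \<le> (norm ((T ^^ Suc k) x))\<^sup>2"
      by simp
    ultimately show "(norm ((T ^^ (Suc k div 2)) x))\<^sup>2 - (norm ((T ^^ Suc k) x))\<^sup>2 \<le> (norm x)\<^sup>2"
      by linarith
  qed simp
  finally have "real k * ?d \<le> 4 * real m * norm x"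
    by simp
  then have "(2 * norm x) * (real k * ?d) \<le> (2 * norm x) * (4 * real m * norm x)"
    by (intro mult_left_mono) auto
  moreover have "real k * loss ((T ^^ k) x) \<le> real k * (2 * norm x * ?d)"
    using norm_iter_le[of k x]
    by (intro mult_left_mono order_trans[OF loss_iter_le] mult_right_mono) auto
  ultimately show ?thesis
    by (simp add: power2_eq_square algebra_simps)
qed

subsection \<open>The sum of the orthogonal complements\<close>

lemma perp_sum_iff:
  "x \<in> perp_sum M m \<longleftrightarrow> (\<exists>u. (\<forall>i<m. u i \<in> (M (Suc i))\<^sup>\<bottom>) \<and> x = (\<Sum>i<m. u i))"
proof -
  have "perp_sum M m = (\<Sum>i<m. (M (Suc i))\<^sup>\<bottom>)"
    by (simp add: perp_sum_def sum.atLeast1_atMost_eq)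
  then show ?thesis
    by (auto simp: set_sum_alt)
qed

lemma subspace_perp_sum: "subspace (perp_sum M m)"
proof (rule subspaceI)
  show "0 \<in> perp_sum M m"
    unfolding perp_sum_iff by (intro exI[of _ "\<lambda>_. 0"]) (auto intro: subspace_0 subspace_orthogonal_comp)
  show "x + y \<in> perp_sum M m" if xy: "x \<in> perp_sum M m" "y \<in> perp_sum M m" for x y
  proof -
    obtain u where "\<forall>i<m. u i \<in> (M (Suc i))\<^sup>\<bottom>" "x = (\<Sum>i<m. u i)"
      using xy(1) unfolding perp_sum_iff by blast
    moreover obtain v where "\<forall>i<m. v i \<in> (M (Suc i))\<^sup>\<bottom>" "y = (\<Sum>i<m. v i)"
      using xy(2) unfolding perp_sum_iff by blast
    ultimately show ?thesis
      unfolding perp_sum_iff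
      by (intro exI[of _ "\<lambda>i. u i + v i"]) (auto simp: sum.distrib intro: subspace_add subspace_orthogonal_comp)
  qed
  show "c *\<^sub>R x \<in> perp_sum M m" if x: "x \<in> perp_sum M m" for c x
  proof -
    obtain u where "\<forall>i<m. u i \<in> (M (Suc i))\<^sup>\<bottom>" "x = (\<Sum>i<m. u i)"
      using x unfolding perp_sum_iff by blast
    then show ?thesis
      unfolding perp_sum_iff
      by (intro exI[of _ "\<lambda>i. c *\<^sub>R u i"]) (auto simp: scaleR_sum_right intro: subspace_mul subspace_orthogonal_comp)
  qed
qed

lemma residual_in_perp_sum:
  assumes "i < m"
  shows "residual (Suc i) x \<in> perp_sum M m"
proof -
  have "residual (Suc i) x \<in> (M (Suc i))\<^sup>\<bottom>"
    using assms by (intro orth_proj_residual M_Suc)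
  then show ?thesis
    unfolding perp_sum_iff using assms
    by (intro exI[of _ "\<lambda>j. if j = i then residual (Suc i) x else 0"])
      (auto intro: subspace_0 subspace_orthogonal_comp)
qed

text \<open>
  The telescoping sum of residuals puts \<open>x - T x\<close> into the algebraic sum and not merely into its
  closure; this is what finally makes the sum closed.
\<close>
lemma displacement_in_perp_sum: "x - T x \<in> perp_sum M m"
  unfolding displacement_eq by (intro subspace_sum subspace_perp_sum residual_in_perp_sum) auto

lemma iter_displacement_in_perp_sum: "x - (T ^^ k) x \<in> perp_sum M m"
proof (induction k)
  case 0
  then show ?case
    by (simp add: subspace_0 subspace_perp_sum)
next
  case (Suc k)
  then have "(x - (T ^^ k) x) + ((T ^^ k) x - T ((T ^^ k) x)) \<in> perp_sum M m"
    by (intro subspace_add subspace_perp_sum displacement_in_perp_sum)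
  then show ?case
    by simp
qed

lemma iter_closure_perp_sum:
  assumes "x \<in> closure (perp_sum M m)"
  shows "(T ^^ k) x \<in> closure (perp_sum M m)"
proof -
  obtain u where u: "\<And>n. u n \<in> perp_sum M m" "u \<longlonglongrightarrow> x"
    using assms unfolding closure_sequential by blast
  have "(\<lambda>n. u n - (x - (T ^^ k) x)) \<longlonglongrightarrow> x - (x - (T ^^ k) x)"
    by (intro tendsto_intros u)
  moreover have "u n - (x - (T ^^ k) x) \<in> perp_sum M m" for n
    by (intro subspace_diff subspace_perp_sum u iter_displacement_in_perp_sum)
  ultimately show ?thesis
    unfolding closure_sequential
    by (intro exI[of _ "\<lambda>n. u n - (x - (T ^^ k) x)"]) simp
qed

end

section \<open>Power rates\<close>

text \<open>
  Enlarging the constant absorbs the finitely many exceptional indices, except for \<open>k = 0\<close>, where the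
  power of \<open>k\<close> is \<open>0\<close>.
\<close>
lemma bigo_powr_iff:
  fixes f :: "nat \<Rightarrow> real"
  shows "f \<in> O(\<lambda>k. real k powr q) \<longleftrightarrow> (\<exists>C\<ge>0. \<forall>k\<ge>1. \<bar>f k\<bar> \<le> C * real k powr q)"
proof
  assume "f \<in> O(\<lambda>k. real k powr q)"
  then obtain c where c: "c > 0" "\<forall>\<^sub>F k in sequentially. norm (f k) \<le> c * norm (real k powr q)"
    by (elim landau_o.bigE)
  then obtain N where N: "\<And>k. N \<le> k \<Longrightarrow> \<bar>f k\<bar> \<le> c * real k powr q"
    unfolding eventually_sequentially by auto
  define D where "D = (\<Sum>k\<le>N. \<bar>f k\<bar> / real k powr q)"
  have D: "0 \<le> D"
    unfolding D_def by (intro sum_nonneg) simp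
  have "\<bar>f k\<bar> \<le> (c + D) * real k powr q" if k: "1 \<le> k" for k
  proof (cases "N \<le> k")
    case True
    have "c * real k powr q \<le> (c + D) * real k powr q"
      using D by (intro mult_right_mono) auto
    then show ?thesis
      using N[OF True] by linarith
  next
    case False
    have "\<bar>f k\<bar> / real k powr q \<le> D"
      unfolding D_def using False by (intro member_le_sum) auto
    also have "\<dots> \<le> c + D"
      using c by simp
    finally show ?thesis
      using k by (simp add: pos_divide_le_eq)
  qed
  then show "\<exists>C\<ge>0. \<forall>k\<ge>1. \<bar>f k\<bar> \<le> C * real k powr q"
    using c D by (intro exI[of _ "c + D"]) auto
next
  assume "\<exists>C\<ge>0. \<forall>k\<ge>1. \<bar>f k\<bar> \<le> C * real k powr q"
  then obtain C where C: "\<forall>k\<ge>1. \<bar>f k\<bar> \<le> C * real k powr q"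
    by blast
  then show "f \<in> O(\<lambda>k. real k powr q)"
    by (intro bigoI[of _ C]) (auto simp: eventually_sequentially intro!: exI[of _ 1])
qed

lemma smallo_powrI:
  fixes f :: "nat \<Rightarrow> real"
  assumes "(\<lambda>k. real k powr p * f k) \<longlonglongrightarrow> 0"
  shows "f \<in> o(\<lambda>k. real k powr (-p))"
proof (rule smalloI_tendsto)
  have "\<forall>\<^sub>F k in sequentially. real k powr p * f k = f k / real k powr (-p)"
    using eventually_gt_at_top[of 0] by eventually_elim (simp add: powr_minus field_simps)
  then show "(\<lambda>k. f k / real k powr (-p)) \<longlonglongrightarrow> 0"
    using assms by (rule Lim_transform_eventually[rotated])
  show "\<forall>\<^sub>F k in sequentially. real k powr (-p) \<noteq> 0"
    using eventually_gt_at_top[of 0] by eventually_elim simp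
qed

text \<open>
  The powers of \<open>k\<close> are moved into the operators, so that uniform boundedness applies.
\<close>
lemma uniform_boundedness_powr:
  fixes F :: "nat \<Rightarrow> 'a::{real_normed_vector, complete_space} \<Rightarrow> 'b::real_normed_vector"
  assumes F: "\<And>k. bounded_linear (F k)"
    and pw: "\<And>x. \<exists>c\<ge>0. \<forall>k\<ge>1. norm (F k x) \<le> c * real k powr q"
  shows "\<exists>C\<ge>0. \<forall>k\<ge>1. \<forall>x. norm (F k x) \<le> C * real k powr q * norm x"
proof -
  have "\<exists>C\<ge>0. \<forall>k x. norm (real k powr (-q) *\<^sub>R F k x) \<le> C * norm x"
  proof (rule uniform_boundedness)
    show "bounded_linear (\<lambda>x. real k powr (-q) *\<^sub>R F k x)" for k
      by (intro bounded_linear_const_scaleR F)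
    fix x
    obtain c where c: "c \<ge> 0" "\<forall>k\<ge>1. norm (F k x) \<le> c * real k powr q"
      using pw by blast
    have "norm (real k powr (-q) *\<^sub>R F k x) \<le> c" for k
      using c by (cases "k = 0") (auto simp: powr_minus field_simps)
    then show "\<exists>c. \<forall>k. norm (real k powr (-q) *\<^sub>R F k x) \<le> c"
      by blast
  qed
  then obtain C where C: "C \<ge> 0" "\<And>k x. norm (real k powr (-q) *\<^sub>R F k x) \<le> C * norm x"
    by blast
  have "norm (F k x) \<le> C * real k powr q * norm x" if "1 \<le> k" for k x
    using C(2)[of k x] that by (simp add: powr_minus field_simps)
  then show ?thesis
    using C(1) by blast
qed

section \<open>The adjoint product\<close>

lemma proj_prod_Suc_right:
  "proj_prod N (Suc n) x = proj_prod (\<lambda>i. N (Suc i)) n (orth_proj (N 1) x)"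
  by (induction n) auto

context closed_subspaces
begin

lemma reversed: "closed_subspaces (\<lambda>i. M (Suc m - i)) m"
  by standard (auto intro!: subspace_M closed_M)

lemma prod_adjoint:
  "n \<le> m \<Longrightarrow> proj_prod M n x \<bullet> y = x \<bullet> proj_prod (\<lambda>i. M (Suc n - i)) n y"
proof (induction n arbitrary: y)
  case (Suc n)
  have "proj_prod M (Suc n) x \<bullet> y = proj_prod M n x \<bullet> orth_proj (M (Suc n)) y"
    using Suc.prems by (simp add: orth_proj_adjoint M_Suc)
  also have "\<dots> = x \<bullet> proj_prod (\<lambda>i. M (Suc n - i)) n (orth_proj (M (Suc n)) y)"
    using Suc by simp
  also have "\<dots> = x \<bullet> proj_prod (\<lambda>i. M (Suc (Suc n) - i)) (Suc n) y"
    unfolding proj_prod_Suc_right by simp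
  finally show ?case .
qed simp

abbreviation "T_adj \<equiv> proj_prod (\<lambda>i. M (Suc m - i)) m"

lemma iter_adjoint: "(T ^^ k) x \<bullet> y = x \<bullet> (T_adj ^^ k) y"
proof (induction k arbitrary: y)
  case (Suc k)
  then show ?case
    using prod_adjoint[of m "(T ^^ k) x" y] by (simp add: funpow_swap1[of T_adj k y])
qed simp

text \<open>
  This adjoint pair transfers rates: a bound for the residuals of the iterates of one product becomes a
  bound for the iterates of the other one that start in \<open>M\<^sub>i\<^sup>\<bottom>\<close>.
\<close>
lemma iter_residual_adjoint:
  "i < m \<Longrightarrow> (T ^^ k) (residual (Suc i) x) \<bullet> y = x \<bullet> residual (Suc i) ((T_adj ^^ k) y)"
  by (simp add: iter_adjoint inner_diff_left inner_diff_right orth_proj_adjoint M_Suc)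

lemma sum_reversed: "(\<Sum>i<m. g (M (Suc m - Suc i))) = (\<Sum>i<m. g (M (Suc i)))"
  by (rule sum.reindex_bij_witness[of _ "\<lambda>i. m - Suc i" "\<lambda>i. m - Suc i"]) (auto simp: Suc_diff_Suc)

lemma perp_sum_reversed: "perp_sum (\<lambda>i. M (Suc m - i)) m = perp_sum M m"
  using sum_reversed[of "\<lambda>L. L\<^sup>\<bottom>"] by (simp add: perp_sum_def sum.atLeast1_atMost_eq)

lemma defect_reversed: "closed_subspaces.defect (\<lambda>i. M (Suc m - i)) m x = defect x"
  using sum_reversed[of "\<lambda>L. (norm (x - orth_proj L x))\<^sup>2"]
  by (simp add: defect_def closed_subspaces.defect_def[OF reversed])

lemma residual_le_defect: "i < m \<Longrightarrow> (norm (residual (Suc i) x))\<^sup>2 \<le> defect x"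
  unfolding defect_def by (intro member_le_sum) auto

section \<open>Rates for arbitrary starting points\<close>

text \<open>
  Since \<open>\<parallel>T\<^sup>k x\<parallel>\<^sup>2\<close> converges, the energy spent on the second half of the iterates tends to \<open>0\<close>.
\<close>
lemma displacement_smallo:
  "(\<lambda>k. norm ((T ^^ k) x - (T ^^ (k - 1)) x)) \<in> o(\<lambda>k. real k powr (-1))"
proof (rule smallo_powrI)
  define E where "E k = (norm ((T ^^ k) x))\<^sup>2" for k
  have "decseq E"
    unfolding E_def by (intro antimonoI power_mono norm_iter_antimono) auto
  then obtain l where l: "E \<longlonglongrightarrow> l"
    using decseq_convergent[of E 0] by (auto simp: E_def)
  have half: "(\<lambda>k. E (k div 2)) \<longlonglongrightarrow> l"
    by (rule filterlim_compose[OF l filterlim_at_top_div_const_nat]) simp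
  have "(\<lambda>k. 4 * real m * sqrt (E (k div 2) - E k)) \<longlonglongrightarrow> 4 * real m * sqrt (l - l)"
    by (intro tendsto_intros half l)
  then have upper: "(\<lambda>k. 4 * real m * sqrt (E (k div 2) - E k)) \<longlonglongrightarrow> 0"
    by simp
  have "\<forall>\<^sub>F k in sequentially.
      real k powr 1 * norm ((T ^^ k) x - (T ^^ (k - 1)) x) \<le> 4 * real m * sqrt (E (k div 2) - E k)"
    using eventually_ge_at_top[of 4]
    by eventually_elim (use displacement_bound in \<open>auto simp: E_def\<close>)
  then show "(\<lambda>k. real k powr 1 * norm ((T ^^ k) x - (T ^^ (k - 1)) x)) \<longlonglongrightarrow> 0"
    by (intro tendsto_sandwich[OF _ _ tendsto_const upper]) auto
qed

text \<open>
  The rate of the displacement carries over because of \<open>S(y) \<le> 2 \<parallel>y\<parallel> \<parallel>y - T y\<parallel>\<close>.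
\<close>
lemma defect_smallo: "(\<lambda>k. sqrt (defect ((T ^^ k) x))) \<in> o(\<lambda>k. real k powr (-1/2))"
proof -
  let ?d = "\<lambda>k. norm ((T ^^ k) x - (T ^^ (k - 1)) x)"
  have "(\<lambda>k. ?d k / real k powr (-1)) \<longlonglongrightarrow> 0"
    by (rule smalloD_tendsto[OF displacement_smallo])
  then have "(\<lambda>k. ?d (Suc k) / real (Suc k) powr (-1)) \<longlonglongrightarrow> 0"
    by (rule LIMSEQ_Suc)
  then have "(\<lambda>k. real (Suc k) * ?d (Suc k)) \<longlonglongrightarrow> 0"
    by (simp add: powr_minus field_simps)
  then have "(\<lambda>k. sqrt ((real m)\<^sup>2 * (2 * norm x * (real (Suc k) * ?d (Suc k)))))
      \<longlonglongrightarrow> sqrt ((real m)\<^sup>2 * (2 * norm x * 0))"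
    by (intro tendsto_intros)
  then have upper: "(\<lambda>k. sqrt ((real m)\<^sup>2 * (2 * norm x * (real (Suc k) * ?d (Suc k))))) \<longlonglongrightarrow> 0"
    by simp
  have "real k powr (1/2) * sqrt (defect ((T ^^ k) x))
      \<le> sqrt ((real m)\<^sup>2 * (2 * norm x * (real (Suc k) * ?d (Suc k))))" for k
  proof -
    have "loss ((T ^^ k) x) \<le> 2 * norm x * ?d (Suc k)"
      using norm_iter_le[of k x] by (intro order_trans[OF loss_iter_le] mult_mono) auto
    then have "real k * defect ((T ^^ k) x) \<le> real (Suc k) * ((real m)\<^sup>2 * (2 * norm x * ?d (Suc k)))"
      by (intro mult_mono order_trans[OF defect_le_loss] mult_left_mono) (auto simp: defect_nonneg)
    then have "sqrt (real k * defect ((T ^^ k) x))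
        \<le> sqrt ((real m)\<^sup>2 * (2 * norm x * (real (Suc k) * ?d (Suc k))))"
      by (intro real_sqrt_le_mono) (simp add: mult_ac)
    then show ?thesis
      by (simp add: powr_half_sqrt real_sqrt_mult)
  qed
  then have "(\<lambda>k. real k powr (1/2) * sqrt (defect ((T ^^ k) x))) \<longlonglongrightarrow> 0"
    by (intro tendsto_sandwich[OF _ _ tendsto_const upper]) (auto simp: defect_nonneg)
  then show ?thesis
    using smallo_powrI by force
qed

section \<open>Rates on the sum of the orthogonal complements\<close>

text \<open>
  The reversed product is of the same kind as \<open>T\<close>, so \<open>loss_iter_bound\<close> bounds the residuals of its
  iterates uniformly by a multiple of \<open>k\<^sup>-\<^sup>1\<^sup>/\<^sup>2\<close>.  Taking adjoints, the same bound holds for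
  \<open>T\<^sup>k (I - P\<^sub>i)\<close>, and \<open>I - P\<^sub>i\<close> is the identity on \<open>M\<^sub>i\<^sup>\<bottom>\<close>.
\<close>
lemma iter_perp_sum_bound:
  assumes x: "x \<in> perp_sum M m"
  shows "\<exists>C\<ge>0. \<forall>k\<ge>1. norm ((T ^^ k) x) \<le> C * real k powr (-1/2)"
proof -
  interpret rev: closed_subspaces "\<lambda>i. M (Suc m - i)" m
    by (rule reversed)
  \<comment> \<open>A factor \<open>m\<^sup>2\<close> comes from \<open>defect_le_loss\<close>, the factor \<open>8 m\<close> from \<open>loss_iter_bound\<close>.\<close>
  define c where "c = sqrt (8 * real m ^ 3)"
  have uniform: "norm ((T ^^ k) (residual (Suc i) y)) \<le> c * real k powr (-1/2) * norm y"
    if i: "i < m" and k: "3 \<le> k" for i k y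
  proof (rule adjoint_norm_le)
    show "residual (Suc i) ((T_adj ^^ k) y) \<bullet> z = y \<bullet> (T ^^ k) (residual (Suc i) z)" for y z
      using iter_residual_adjoint[OF i, of k z y] by (simp add: inner_commute)
    fix y
    let ?z = "(T_adj ^^ k) y"
    have "real k * (norm (residual (Suc i) ?z))\<^sup>2 \<le> real k * ((real m)\<^sup>2 * rev.loss ?z)"
      using residual_le_defect[OF i, of ?z] rev.defect_le_loss[of ?z]
      by (intro mult_left_mono) (auto simp: defect_reversed)
    also have "\<dots> = (real m)\<^sup>2 * (real k * rev.loss ?z)"
      by simp
    also have "\<dots> \<le> (real m)\<^sup>2 * (8 * real m * (norm y)\<^sup>2)"
      by (intro mult_left_mono rev.loss_iter_bound k) simp
    finally have "(norm (residual (Suc i) ?z))\<^sup>2 \<le> 8 * real m ^ 3 / real k * (norm y)\<^sup>2"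
      using k by (simp add: field_simps power2_eq_square power3_eq_cube)
    also have "\<dots> = (c * real k powr (-1/2) * norm y)\<^sup>2"
      using k by (simp add: c_def power_mult_distrib powr_minus powr_half_sqrt field_simps)
    finally show "norm (residual (Suc i) ?z) \<le> c * real k powr (-1/2) * norm y"
      by (rule power2_le_imp_le) (simp add: c_def)
  qed
  obtain u where u: "\<forall>i<m. u i \<in> (M (Suc i))\<^sup>\<bottom>" "x = (\<Sum>i<m. u i)"
    using x unfolding perp_sum_iff by blast
  have "norm ((T ^^ k) x) \<le> (\<Sum>i<m. c * norm (u i)) * real k powr (-1/2)" if k: "3 \<le> k" for k
  proof -
    have "norm ((T ^^ k) x) \<le> (\<Sum>i<m. norm ((T ^^ k) (u i)))"
      unfolding u(2) linear_sum[OF bounded_linear.linear[OF bounded_linear_iter]] by (rule norm_sum)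
    also have "\<dots> \<le> (\<Sum>i<m. c * real k powr (-1/2) * norm (u i))"
    proof (rule sum_mono)
      fix i
      assume "i \<in> {..<m}"
      then have i: "i < m"
        by simp
      then have "orth_proj (M (Suc i)) (u i) = 0"
        using u(1) by (intro orth_proj_perp M_Suc) auto
      then show "norm ((T ^^ k) (u i)) \<le> c * real k powr (-1/2) * norm (u i)"
        using uniform[OF i k, of "u i"] by simp
    qed
    finally show ?thesis
      by (simp add: sum_distrib_right mult_ac)
  qed
  then have "(\<lambda>k. norm ((T ^^ k) x)) \<in> O(\<lambda>k. real k powr (-1/2))"
    by (intro bigoI[of _ "\<Sum>i<m. c * norm (u i)"]) (auto simp: eventually_sequentially intro!: exI[of _ 3])
  then show ?thesis
    unfolding bigo_powr_iff by simp
qed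

text \<open>
  The factor \<open>1/k\<close> comes from the second half of the iterates, the factor \<open>k\<^sup>-\<^sup>1\<^sup>/\<^sup>2\<close> from the norm
  that the first half has already reached.
\<close>
lemma displacement_perp_sum_bound:
  assumes x: "x \<in> perp_sum M m"
  shows "\<exists>C\<ge>0. \<forall>k\<ge>1. norm ((T ^^ k) x - (T ^^ (k - 1)) x) \<le> C * real k powr (-3/2)"
proof -
  obtain C where C: "C \<ge> 0" "\<And>k. 1 \<le> k \<Longrightarrow> norm ((T ^^ k) x) \<le> C * real k powr (-1/2)"
    using iter_perp_sum_bound[OF x] by blast
  have "norm ((T ^^ k) x - (T ^^ (k - 1)) x) \<le> 8 * real m * C * real k powr (-3/2)" if k: "4 \<le> k" for k
  proof -
    let ?h = "k div 2" and ?d = "norm ((T ^^ k) x - (T ^^ (k - 1)) x)"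
    have h: "real k \<le> 4 * real ?h" "1 \<le> ?h"
      using k by linarith+
    have "real k * ?d \<le> 4 * real m * sqrt ((norm ((T ^^ ?h) x))\<^sup>2 - (norm ((T ^^ k) x))\<^sup>2)"
      using k by (rule displacement_bound)
    also have "\<dots> \<le> 4 * real m * sqrt ((norm ((T ^^ ?h) x))\<^sup>2)"
      by (intro mult_left_mono real_sqrt_le_mono) auto
    also have "\<dots> \<le> 4 * real m * (C * real ?h powr (-1/2))"
      using C(2)[OF h(2)] by (simp add: mult_left_mono)
    also have "real ?h powr (-1/2) \<le> (real k / 4) powr (-1/2)"
      using h k by (intro powr_mono2') auto
    also have "(real k / 4) powr (-1/2) = 2 * real k powr (-1/2)"
      using k by (simp add: powr_divide powr_minus powr_half_sqrt field_simps)
    finally have "real k * ?d \<le> 8 * real m * C * real k powr (-1/2)"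
      using C(1) by (simp add: mult_left_mono)
    moreover have "real k powr (-1/2) = real k * real k powr (-3/2)"
      using k by (simp add: powr_mult_base)
    ultimately show ?thesis
      using k by (simp add: mult_ac)
  qed
  then have "(\<lambda>k. norm ((T ^^ k) x - (T ^^ (k - 1)) x)) \<in> O(\<lambda>k. real k powr (-3/2))"
    by (intro bigoI[of _ "8 * real m * C"]) (auto simp: eventually_sequentially intro!: exI[of _ 4])
  then show ?thesis
    unfolding bigo_powr_iff by simp
qed

text \<open>
  The loss at \<open>y = T\<^sup>k x\<close> is at most \<open>2 \<parallel>y\<parallel> \<parallel>y - T y\<parallel>\<close>, and the rates \<open>1/2\<close> and \<open>3/2\<close> of the two
  factors add up.
\<close>
lemma loss_perp_sum_bound:
  assumes x: "x \<in> perp_sum M m"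
  shows "\<exists>C\<ge>0. \<forall>k\<ge>1. loss ((T ^^ k) x) \<le> C * real k powr (-2)"
proof -
  obtain C where C: "C \<ge> 0" "\<And>k. 1 \<le> k \<Longrightarrow> norm ((T ^^ k) x) \<le> C * real k powr (-1/2)"
    using iter_perp_sum_bound[OF x] by blast
  obtain D where D: "D \<ge> 0"
    "\<And>k. 1 \<le> k \<Longrightarrow> norm ((T ^^ k) x - (T ^^ (k - 1)) x) \<le> D * real k powr (-3/2)"
    using displacement_perp_sum_bound[OF x] by blast
  have "loss ((T ^^ k) x) \<le> 2 * C * D * real k powr (-2)" if k: "1 \<le> k" for k
  proof -
    have "real (Suc k) powr (-3/2) \<le> real k powr (-3/2)"
      using k by (intro powr_mono2') auto
    then have d: "norm ((T ^^ Suc k) x - (T ^^ k) x) \<le> D * real k powr (-3/2)"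
      using D(2)[of "Suc k"] D(1) by (auto intro: order_trans mult_left_mono)
    have "loss ((T ^^ k) x) \<le> 2 * norm ((T ^^ k) x) * norm ((T ^^ Suc k) x - (T ^^ k) x)"
      by (rule loss_iter_le)
    also have "\<dots> \<le> 2 * (C * real k powr (-1/2)) * (D * real k powr (-3/2))"
      using C(1) C(2)[OF k] d by (intro mult_mono) auto
    also have "\<dots> = 2 * C * D * (real k powr (-1/2) * real k powr (-3/2))"
      by simp
    also have "real k powr (-1/2) * real k powr (-3/2) = real k powr (-2)"
      by (simp flip: powr_add)
    finally show ?thesis .
  qed
  then show ?thesis
    using C(1) D(1) by (intro exI[of _ "2 * C * D"]) auto
qed

lemma defect_perp_sum_bound:
  assumes x: "x \<in> perp_sum M m"
  shows "(\<lambda>k. sqrt (defect ((T ^^ k) x))) \<in> O(\<lambda>k. real k powr (-1))"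
proof -
  obtain C where C: "C \<ge> 0" "\<And>k. 1 \<le> k \<Longrightarrow> loss ((T ^^ k) x) \<le> C * real k powr (-2)"
    using loss_perp_sum_bound[OF x] by blast
  have "sqrt (defect ((T ^^ k) x)) \<le> (real m * sqrt C) * real k powr (-1)" if k: "1 \<le> k" for k
  proof (rule real_le_lsqrt)
    have "defect ((T ^^ k) x) \<le> (real m)\<^sup>2 * (C * real k powr (-2))"
      using C(2)[OF k] by (intro order_trans[OF defect_le_loss] mult_left_mono) auto
    also have "-2 = (-1) + (-1 :: real)"
      by simp
    also have "real k powr \<dots> = (real k powr (-1))\<^sup>2"
      by (simp only: power2_eq_square powr_add)
    finally show "defect ((T ^^ k) x) \<le> ((real m * sqrt C) * real k powr (-1))\<^sup>2"
      using C(1) by (simp add: power_mult_distrib power_divide mult_ac)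
  qed (use C in auto)
  then show ?thesis
    unfolding bigo_powr_iff using C(1)
    by (intro exI[of _ "real m * sqrt C"]) (auto simp: defect_nonneg)
qed

text \<open>
  By the rate on the algebraic sum and because \<open>T\<close> is nonexpansive.
\<close>
lemma iter_tendsto_0:
  assumes x: "x \<in> closure (perp_sum M m)"
  shows "(\<lambda>k. (T ^^ k) x) \<longlonglongrightarrow> 0"
proof (rule LIMSEQ_I)
  fix e :: real
  assume e: "0 < e"
  obtain u where u: "u \<in> perp_sum M m" "dist u x < e / 2"
    using x e unfolding closure_approachable by (metis half_gt_zero)
  obtain C where C: "\<And>k. 1 \<le> k \<Longrightarrow> norm ((T ^^ k) u) \<le> C * real k powr (-1/2)"
    using iter_perp_sum_bound[OF u(1)] by blast
  have "(\<lambda>k. C * real k powr (-1/2)) \<longlonglongrightarrow> C * 0"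
    by (intro tendsto_intros tendsto_neg_powr filterlim_real_sequentially) simp
  then have "\<forall>\<^sub>F k in sequentially. C * real k powr (-1/2) < e / 2"
    using e by (intro order_tendstoD(2)[where y = "C * 0"]) auto
  then obtain N where N: "\<And>k. N \<le> k \<Longrightarrow> C * real k powr (-1/2) < e / 2"
    unfolding eventually_sequentially by blast
  have "norm ((T ^^ k) x - 0) < e" if "max 1 N \<le> k" for k
  proof -
    have "(T ^^ k) x = (T ^^ k) (x - u) + (T ^^ k) u"
      by (simp add: linear_simps[OF bounded_linear_iter])
    then have "norm ((T ^^ k) x) \<le> norm ((T ^^ k) (x - u)) + norm ((T ^^ k) u)"
      using norm_triangle_ineq by metis
    also have "norm ((T ^^ k) (x - u)) < e / 2"
      using norm_iter_le[of k "x - u"] u(2) by (simp add: dist_norm norm_minus_commute)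
    also have "norm ((T ^^ k) u) < e / 2"
      using C[of k] N[of k] that by simp
    finally show ?thesis
      by simp
  qed
  then show "\<exists>N. \<forall>k\<ge>N. norm ((T ^^ k) x - 0) < e"
    by blast
qed

end

section \<open>Fast convergence forces closedness\<close>

text \<open>
  The comparison test, for the sort of the ambient Hilbert space instead of the class \<open>banach\<close>.
\<close>
lemma convergent_if_norm_summable:
  fixes f :: "nat \<Rightarrow> 'a::{real_normed_vector, complete_space}"
  assumes f: "\<And>j. norm (f j) \<le> g j" and g: "summable g"
  shows "convergent (\<lambda>n. \<Sum>j<n. f j)"
proof -
  have "Cauchy (\<lambda>n. \<Sum>j<n. f j)"
  proof (rule CauchyI')
    fix e :: real
    assume "0 < e"
    then obtain N where N: "\<And>p q. N \<le> p \<Longrightarrow> norm (sum g {p..<q}) < e"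
      using g unfolding summable_Cauchy by blast
    have "dist (\<Sum>j<p. f j) (\<Sum>j<q. f j) < e" if p: "N \<le> p" "p < q" for p q
    proof -
      have "(\<Sum>j<q. f j) - (\<Sum>j<p. f j) = sum f {p..<q}"
        using sum_diff_nat_ivl[of 0 p q f] p by (simp add: lessThan_atLeast0)
      then have "dist (\<Sum>j<p. f j) (\<Sum>j<q. f j) = norm (sum f {p..<q})"
        by (metis dist_norm norm_minus_commute)
      also have "\<dots> \<le> sum g {p..<q}"
        using f by (intro order_trans[OF norm_sum] sum_mono) auto
      also have "\<dots> < e"
        using N[OF p(1), of q] by simp
      finally show ?thesis .
    qed
    then show "\<exists>N. \<forall>p\<ge>N. \<forall>q>p. dist (\<Sum>j<p. f j) (\<Sum>j<q. f j) < e"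
      by blast
  qed
  then show ?thesis
    by (simp add: Cauchy_convergent_iff)
qed

context closed_subspaces
begin


text \<open>
  The geometric series \<open>z = \<Sum>\<^sub>j T\<^sup>j\<^sup>n x\<close> solves \<open>x = z - T\<^sup>n z\<close>, and the right-hand side lies in
  \<open>\<Sum>\<^sub>i M\<^sub>i\<^sup>\<bottom>\<close> for every \<open>z\<close> whatsoever.
\<close>
lemma closed_perp_sum_if_contraction:
  assumes contr: "\<And>x. x \<in> closure (perp_sum M m) \<Longrightarrow> norm ((T ^^ n) x) \<le> norm x / 2"
  shows "closed (perp_sum M m)"
proof -
  let ?A = "T ^^ n"
  have "x \<in> perp_sum M m" if x: "x \<in> closure (perp_sum M m)" for x
  proof -
    have lin: "bounded_linear ?A"
      by (rule bounded_linear_iter)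
    have mem: "(?A ^^ j) x \<in> closure (perp_sum M m)" for j
      by (induction j) (simp_all add: x iter_closure_perp_sum)
    have geom: "norm ((?A ^^ j) x) \<le> norm x * (1/2) ^ j" for j
    proof (induction j)
      case (Suc j)
      then show ?case
        using contr[OF mem[of j]] by simp
    qed simp
    define s where "s j = (\<Sum>i<j. (?A ^^ i) x)" for j
    have "summable (\<lambda>j. norm x * (1/2 :: real) ^ j)"
      by (intro summable_mult summable_geometric) simp
    from convergent_if_norm_summable[OF geom this] obtain z where z: "s \<longlonglongrightarrow> z"
      unfolding s_def convergent_def by blast
    have "?A (s j) = s (Suc j) - x" for j
      unfolding s_def linear_sum[OF bounded_linear.linear[OF lin]]
      by (subst sum.lessThan_Suc_shift) simp
    moreover have "(\<lambda>j. ?A (s j)) \<longlonglongrightarrow> ?A z"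
      by (rule bounded_linear.tendsto[OF lin z])
    moreover have "(\<lambda>j. s (Suc j) - x) \<longlonglongrightarrow> z - x"
      by (intro tendsto_intros LIMSEQ_Suc z)
    ultimately have "?A z = z - x"
      using LIMSEQ_unique by simp
    then have "x = z - ?A z"
      by simp
    then show ?thesis
      using iter_displacement_in_perp_sum[of z n] by simp
  qed
  then show ?thesis
    by (metis closure_subset_eq subsetI)
qed

text \<open>
  The decay is uniform in \<open>x\<close>, so \<open>\<parallel>T\<^sup>n x\<parallel>\<^sup>2\<close>, the sum of the losses from \<open>n\<close> on, is at most
  \<open>B n\<^sup>-\<^sup>2\<^sup>\<epsilon> \<parallel>x\<parallel>\<^sup>2\<close> on the closure of \<open>\<Sum>\<^sub>i M\<^sub>i\<^sup>\<bottom>\<close>, where the iterates tend to \<open>0\<close>.  For a large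
  \<open>n\<close> this makes \<open>T\<^sup>n\<close> a contraction there.
\<close>
lemma closed_perp_sum_if_residual_decay:
  assumes \<epsilon>: "0 < \<epsilon>"
    and decay: "\<And>i. i < m \<Longrightarrow> \<exists>C\<ge>0. \<forall>k\<ge>1. \<forall>x.
      norm (residual (Suc i) ((T ^^ k) x)) \<le> C * real k powr (-1/2 - \<epsilon>) * norm x"
  shows "closed (perp_sum M m)"
proof -
  obtain C where C: "\<And>i k x. i < m \<Longrightarrow> 1 \<le> k \<Longrightarrow>
      norm (residual (Suc i) ((T ^^ k) x)) \<le> C i * real k powr (-1/2 - \<epsilon>) * norm x"
    using decay by metis
  define K where "K = (real m)\<^sup>2 * (\<Sum>i<m. (C i)\<^sup>2)"
  have K: "0 \<le> K"
    unfolding K_def by (intro mult_nonneg_nonneg sum_nonneg) auto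
  have loss_decay: "loss ((T ^^ k) x) \<le> K * (norm x)\<^sup>2 * real k powr (-1 - 2 * \<epsilon>)" if k: "1 \<le> k" for k x
  proof -
    have "(-1/2 - \<epsilon>) + (-1/2 - \<epsilon>) = -1 - 2 * \<epsilon>"
      by simp
    then have sq: "(real k powr (-1/2 - \<epsilon>))\<^sup>2 = real k powr (-1 - 2 * \<epsilon>)"
      by (simp only: power2_eq_square flip: powr_add)
    have "defect ((T ^^ k) x) \<le> (\<Sum>i<m. (C i * real k powr (-1/2 - \<epsilon>) * norm x)\<^sup>2)"
      unfolding defect_def using C k by (intro sum_mono power_mono) auto
    also have "\<dots> = (\<Sum>i<m. (C i)\<^sup>2) * real k powr (-1 - 2 * \<epsilon>) * (norm x)\<^sup>2"
      by (simp only: power_mult_distrib sq sum_distrib_right)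
    finally have "(real m)\<^sup>2 * defect ((T ^^ k) x)
        \<le> (real m)\<^sup>2 * ((\<Sum>i<m. (C i)\<^sup>2) * real k powr (-1 - 2 * \<epsilon>) * (norm x)\<^sup>2)"
      by (intro mult_left_mono) auto
    then show ?thesis
      using loss_le_defect[of "(T ^^ k) x"] by (simp add: K_def mult_ac)
  qed
  define B where "B = K * (2 powr (1 + 2 * \<epsilon>) / (2 * \<epsilon>))"
  have bound: "(norm ((T ^^ n) x))\<^sup>2 \<le> B * real n powr (- (2 * \<epsilon>)) * (norm x)\<^sup>2"
    if x: "x \<in> closure (perp_sum M m)" and n: "1 \<le> n" for x n
  proof -
    have "(norm ((T ^^ n) x))\<^sup>2
        \<le> K * (norm x)\<^sup>2 * (2 powr (1 + 2 * \<epsilon>) / (2 * \<epsilon>)) * real n powr (- (2 * \<epsilon>))"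
    proof (rule telescoping_tail_bound[where f = "\<lambda>k. (norm ((T ^^ k) x))\<^sup>2"])
      have "(\<lambda>k. (norm ((T ^^ k) x))\<^sup>2) \<longlonglongrightarrow> (norm (0::'a))\<^sup>2"
        by (intro tendsto_intros iter_tendsto_0 x)
      then show "(\<lambda>k. (norm ((T ^^ k) x))\<^sup>2) \<longlonglongrightarrow> 0"
        by simp
      show "(norm ((T ^^ k) x))\<^sup>2 - (norm ((T ^^ Suc k) x))\<^sup>2 \<le> K * (norm x)\<^sup>2 * real k powr (-1 - 2 * \<epsilon>)"
        if "1 \<le> k" for k
        using loss_decay[OF that, of x] by (simp add: loss_def)
    qed (use \<epsilon> K n in auto)
    then show ?thesis
      by (simp add: B_def mult_ac)
  qed
  have "(\<lambda>n. B * real n powr (- (2 * \<epsilon>))) \<longlonglongrightarrow> B * 0"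
    using \<epsilon> by (intro tendsto_intros tendsto_neg_powr filterlim_real_sequentially) simp
  then have "\<forall>\<^sub>F n in sequentially. B * real n powr (- (2 * \<epsilon>)) < 1 / 4"
    by (intro order_tendstoD(2)[where y = "B * 0"]) auto
  then have "\<forall>\<^sub>F n in sequentially. 1 \<le> n \<and> B * real n powr (- (2 * \<epsilon>)) < 1 / 4"
    using eventually_ge_at_top by (rule eventually_conj[rotated])
  then obtain n where n: "1 \<le> n" "B * real n powr (- (2 * \<epsilon>)) < 1 / 4"
    using eventually_happens' sequentially_bot by blast
  show ?thesis
  proof (rule closed_perp_sum_if_contraction)
    fix x
    assume x: "x \<in> closure (perp_sum M m)"
    have "(norm ((T ^^ n) x))\<^sup>2 \<le> B * real n powr (- (2 * \<epsilon>)) * (norm x)\<^sup>2"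
      by (rule bound[OF x n(1)])
    also have "\<dots> \<le> 1 / 4 * (norm x)\<^sup>2"
      using n(2) by (intro mult_right_mono) auto
    also have "\<dots> = (norm x / 2)\<^sup>2"
      by (simp add: power2_eq_square)
    finally show "norm ((T ^^ n) x) \<le> norm x / 2"
      by (rule power2_le_imp_le) simp
  qed
qed

text \<open>
  Uniform boundedness, applied to each of the \<open>m\<close> sequences \<open>(I - P\<^sub>i) T\<^sup>k\<close>, removes the dependence
  of the constant on the starting point.
\<close>
lemma closed_perp_sum_if_defect_decay:
  assumes \<epsilon>: "0 < \<epsilon>"
    and decay: "\<And>x. \<exists>C\<ge>0. \<forall>k\<ge>1. sqrt (defect ((T ^^ k) x)) \<le> C * real k powr (-1/2 - \<epsilon>)"
  shows "closed (perp_sum M m)"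
proof (rule closed_perp_sum_if_residual_decay[OF \<epsilon>])
  fix i
  assume i: "i < m"
  show "\<exists>C\<ge>0. \<forall>k\<ge>1. \<forall>x. norm (residual (Suc i) ((T ^^ k) x)) \<le> C * real k powr (-1/2 - \<epsilon>) * norm x"
  proof (rule uniform_boundedness_powr)
    show "bounded_linear (\<lambda>x. residual (Suc i) ((T ^^ k) x))" for k
      using i by (intro bounded_linear_sub bounded_linear_iter
          bounded_linear_compose[OF bounded_linear_orth_proj[OF M_Suc]])
    fix x
    obtain C where C: "C \<ge> 0" "\<forall>k\<ge>1. sqrt (defect ((T ^^ k) x)) \<le> C * real k powr (-1/2 - \<epsilon>)"
      using decay by blast
    have "norm (residual (Suc i) y) \<le> sqrt (defect y)" for y
      using residual_le_defect[OF i] by (rule real_le_rsqrt)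
    then show "\<exists>C\<ge>0. \<forall>k\<ge>1. norm (residual (Suc i) ((T ^^ k) x)) \<le> C * real k powr (-1/2 - \<epsilon>)"
      using C order_trans by blast
  qed
qed

text \<open>
  Since \<open>S(y) \<le> 2 \<parallel>y\<parallel> \<parallel>y - T y\<parallel>\<close>, a displacement of order \<open>k\<^sup>-\<^sup>1\<^sup>-\<^sup>\<epsilon>\<close> gives a root of the defect
  of order \<open>k\<^sup>-\<^sup>1\<^sup>/\<^sup>2\<^sup>-\<^sup>\<epsilon>\<^sup>/\<^sup>2\<close>.
\<close>
lemma closed_perp_sum_if_displacement_decay:
  assumes \<epsilon>: "0 < \<epsilon>"
    and decay: "\<And>x. \<exists>C\<ge>0. \<forall>k\<ge>1. norm ((T ^^ k) x - (T ^^ (k - 1)) x) \<le> C * real k powr (-1 - \<epsilon>)"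
  shows "closed (perp_sum M m)"
proof (rule closed_perp_sum_if_defect_decay[of "\<epsilon> / 2"])
  fix x
  obtain C where C: "C \<ge> 0"
    "\<And>k. 1 \<le> k \<Longrightarrow> norm ((T ^^ k) x - (T ^^ (k - 1)) x) \<le> C * real k powr (-1 - \<epsilon>)"
    using decay by blast
  define B where "B = (real m)\<^sup>2 * (2 * norm x * C)"
  have "sqrt (defect ((T ^^ k) x)) \<le> sqrt B * real k powr (-1/2 - \<epsilon> / 2)" if k: "1 \<le> k" for k
  proof -
    have "norm ((T ^^ Suc k) x - (T ^^ k) x) \<le> C * real (Suc k) powr (-1 - \<epsilon>)"
      using C(2)[of "Suc k"] by simp
    also have "\<dots> \<le> C * real k powr (-1 - \<epsilon>)"
      using k \<epsilon> C(1) by (intro mult_left_mono powr_mono2') auto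
    finally have "loss ((T ^^ k) x) \<le> 2 * norm x * (C * real k powr (-1 - \<epsilon>))"
      using norm_iter_le[of k x] by (intro order_trans[OF loss_iter_le] mult_mono) auto
    then have "(real m)\<^sup>2 * loss ((T ^^ k) x) \<le> (real m)\<^sup>2 * (2 * norm x * (C * real k powr (-1 - \<epsilon>)))"
      by (intro mult_left_mono) auto
    then have "defect ((T ^^ k) x) \<le> B * real k powr (-1 - \<epsilon>)"
      using defect_le_loss[of "(T ^^ k) x"] by (simp add: B_def mult_ac)
    also have "-1 - \<epsilon> = (-1/2 - \<epsilon> / 2) + (-1/2 - \<epsilon> / 2)"
      by simp
    also have "real k powr \<dots> = (real k powr (-1/2 - \<epsilon> / 2))\<^sup>2"
      by (simp only: power2_eq_square powr_add)
    finally show ?thesis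
      by (metis real_sqrt_le_mono real_sqrt_mult real_sqrt_abs abs_of_nonneg powr_ge_zero)
  qed
  then show "\<exists>C\<ge>0. \<forall>k\<ge>1. sqrt (defect ((T ^^ k) x)) \<le> C * real k powr (-1/2 - \<epsilon> / 2)"
    using C(1) by (intro exI[of _ "sqrt B"]) (auto simp: B_def)
qed (use \<epsilon> in simp)

text \<open>
  Uniform boundedness is applied to \<open>T\<^sup>k (I - P\<^sub>i)\<close>, whose values are iterates of points of
  \<open>M\<^sub>i\<^sup>\<bottom>\<close>.  The adjoints are residuals of the iterates of the reversed product, which has the same
  sum of complements; so the conclusion comes from the reversed product.
\<close>
lemma closed_perp_sum_if_iter_decay:
  assumes \<epsilon>: "0 < \<epsilon>"
    and decay: "\<And>x. x \<in> perp_sum M m \<Longrightarrow> \<exists>C\<ge>0. \<forall>k\<ge>1. norm ((T ^^ k) x) \<le> C * real k powr (-1/2 - \<epsilon>)"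
  shows "closed (perp_sum M m)"
proof -
  interpret rev: closed_subspaces "\<lambda>i. M (Suc m - i)" m
    by (rule reversed)
  have "closed (perp_sum (\<lambda>i. M (Suc m - i)) m)"
  proof (rule rev.closed_perp_sum_if_residual_decay[OF \<epsilon>])
    fix j
    assume j: "j < m"
    define i where "i = m - Suc j"
    have i: "i < m" "Suc m - Suc j = Suc i"
      using j by (auto simp: i_def)
    have "\<exists>C\<ge>0. \<forall>k\<ge>1. \<forall>x. norm ((T ^^ k) (residual (Suc i) x)) \<le> C * real k powr (-1/2 - \<epsilon>) * norm x"
    proof (rule uniform_boundedness_powr)
      show "bounded_linear (\<lambda>x. (T ^^ k) (residual (Suc i) x))" for k
        using i(1) by (intro bounded_linear_compose[OF bounded_linear_iter] bounded_linear_sub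
            bounded_linear_ident bounded_linear_orth_proj M_Suc)
    qed (intro decay residual_in_perp_sum i)
    then obtain C where C: "C \<ge> 0"
      "\<And>k x. 1 \<le> k \<Longrightarrow> norm ((T ^^ k) (residual (Suc i) x)) \<le> C * real k powr (-1/2 - \<epsilon>) * norm x"
      by blast
    have "norm (residual (Suc i) ((T_adj ^^ k) y)) \<le> C * real k powr (-1/2 - \<epsilon>) * norm y" if "1 \<le> k" for k y
      by (rule adjoint_norm_le[OF iter_residual_adjoint[OF i(1)] C(2)[OF that]])
    then show "\<exists>C\<ge>0. \<forall>k\<ge>1. \<forall>x. norm ((T_adj ^^ k) x - orth_proj (M (Suc m - Suc j)) ((T_adj ^^ k) x))
        \<le> C * real k powr (-1/2 - \<epsilon>) * norm x"
      unfolding i using C(1) by blast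
  qed
  then show ?thesis
    by (simp only: perp_sum_reversed)
qed

text \<open>
  \<open>\<parallel>T\<^sup>n x\<parallel>\<close> is at most the sum of the displacements from \<open>n\<close> on, which gains a factor \<open>n\<close>.
\<close>
lemma closed_perp_sum_if_displacement_decay_perp_sum:
  assumes \<epsilon>: "0 < \<epsilon>"
    and decay: "\<And>x. x \<in> perp_sum M m \<Longrightarrow>
      \<exists>C\<ge>0. \<forall>k\<ge>1. norm ((T ^^ k) x - (T ^^ (k - 1)) x) \<le> C * real k powr (-3/2 - \<epsilon>)"
  shows "closed (perp_sum M m)"
proof (rule closed_perp_sum_if_iter_decay[OF \<epsilon>])
  fix x
  assume x: "x \<in> perp_sum M m"
  obtain C where C: "C \<ge> 0"
    "\<And>k. 1 \<le> k \<Longrightarrow> norm ((T ^^ k) x - (T ^^ (k - 1)) x) \<le> C * real k powr (-3/2 - \<epsilon>)"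
    using decay[OF x] by blast
  \<comment> \<open>The displacements are of order \<open>k\<^sup>-\<^sup>1\<^sup>-\<^sup>\<delta>\<close>, the norms of order \<open>k\<^sup>-\<^sup>\<delta>\<close>.\<close>
  define \<delta> where "\<delta> = 1/2 + \<epsilon>"
  have \<delta>: "0 < \<delta>" "-3/2 - \<epsilon> = -1 - \<delta>" "-1/2 - \<epsilon> = -\<delta>"
    using \<epsilon> by (simp_all add: \<delta>_def)
  have "norm ((T ^^ n) x) \<le> C * (2 powr (1 + \<delta>) / \<delta>) * real n powr (-\<delta>)" if n: "1 \<le> n" for n
  proof (rule telescoping_tail_bound[where f = "\<lambda>k. norm ((T ^^ k) x)"])
    show "(\<lambda>k. norm ((T ^^ k) x)) \<longlonglongrightarrow> 0"
      using x closure_subset by (intro tendsto_norm_zero iter_tendsto_0) auto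
    fix k :: nat
    assume k: "1 \<le> k"
    have "norm ((T ^^ k) x) - norm ((T ^^ Suc k) x) \<le> norm ((T ^^ Suc k) x - (T ^^ k) x)"
      using norm_triangle_ineq2 norm_minus_commute by metis
    also have "\<dots> \<le> C * real (Suc k) powr (-1 - \<delta>)"
      unfolding \<delta>(2)[symmetric] using C(2)[of "Suc k"] by simp
    also have "\<dots> \<le> C * real k powr (-1 - \<delta>)"
      using k \<delta> C(1) by (intro mult_left_mono powr_mono2') auto
    finally show "norm ((T ^^ k) x) - norm ((T ^^ Suc k) x) \<le> C * real k powr (-1 - \<delta>)" .
  qed (use C \<delta> n in auto)
  then show "\<exists>C\<ge>0. \<forall>k\<ge>1. norm ((T ^^ k) x) \<le> C * real k powr (-1/2 - \<epsilon>)"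
    unfolding \<delta>(3) using C(1) \<delta>(1) by (intro exI[of _ "C * (2 powr (1 + \<delta>) / \<delta>)"]) auto
qed

text \<open>
  \<open>\<parallel>T\<^sup>n x\<parallel>\<^sup>2\<close> is the sum of the losses from \<open>n\<close> on.  These are of order \<open>k\<^sup>-\<^sup>2\<^sup>-\<^sup>2\<^sup>\<epsilon>\<close>, and so the
  sum is of order \<open>n\<^sup>-\<^sup>1\<^sup>-\<^sup>2\<^sup>\<epsilon>\<close>.
\<close>
lemma closed_perp_sum_if_defect_decay_perp_sum:
  assumes \<epsilon>: "0 < \<epsilon>"
    and decay: "\<And>x. x \<in> perp_sum M m \<Longrightarrow>
      \<exists>C\<ge>0. \<forall>k\<ge>1. sqrt (defect ((T ^^ k) x)) \<le> C * real k powr (-1 - \<epsilon>)"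
  shows "closed (perp_sum M m)"
proof (rule closed_perp_sum_if_iter_decay[OF \<epsilon>])
  fix x
  assume x: "x \<in> perp_sum M m"
  obtain C where C: "C \<ge> 0" "\<And>k. 1 \<le> k \<Longrightarrow> sqrt (defect ((T ^^ k) x)) \<le> C * real k powr (-1 - \<epsilon>)"
    using decay[OF x] by blast
  \<comment> \<open>The losses are of order \<open>k\<^sup>-\<^sup>1\<^sup>-\<^sup>\<delta>\<close>, the squared norms of order \<open>k\<^sup>-\<^sup>\<delta>\<close>.\<close>
  define \<delta> where "\<delta> = 1 + 2 * \<epsilon>"
  have \<delta>: "0 < \<delta>" "2 * (-1 - \<epsilon>) = -1 - \<delta>" "-1/2 - \<epsilon> = -\<delta> / 2"
    using \<epsilon> by (simp_all add: \<delta>_def field_simps)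
  define K where "K = (real m)\<^sup>2 * C\<^sup>2"
  define B where "B = K * (2 powr (1 + \<delta>) / \<delta>)"
  have B: "0 \<le> B"
    using \<delta>(1) by (simp add: B_def K_def)
  have "norm ((T ^^ n) x) \<le> sqrt B * real n powr (-\<delta> / 2)" if n: "1 \<le> n" for n
  proof -
    have "(norm ((T ^^ n) x))\<^sup>2 \<le> K * (2 powr (1 + \<delta>) / \<delta>) * real n powr (-\<delta>)"
    proof (rule telescoping_tail_bound[where f = "\<lambda>k. (norm ((T ^^ k) x))\<^sup>2"])
      have "(\<lambda>k. (norm ((T ^^ k) x))\<^sup>2) \<longlonglongrightarrow> (norm (0::'a))\<^sup>2"
        using x closure_subset by (intro tendsto_intros iter_tendsto_0) auto
      then show "(\<lambda>k. (norm ((T ^^ k) x))\<^sup>2) \<longlonglongrightarrow> 0"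
        by simp
      fix k :: nat
      assume k: "1 \<le> k"
      have "defect ((T ^^ k) x) \<le> (C * real k powr (-1 - \<epsilon>))\<^sup>2"
        using C(2)[OF k] by (rule sqrt_le_D)
      also have "\<dots> = C\<^sup>2 * real k powr (-1 - \<delta>)"
        by (simp add: power_mult_distrib power2_eq_square flip: powr_add \<delta>(2))
      finally have "(real m)\<^sup>2 * defect ((T ^^ k) x) \<le> (real m)\<^sup>2 * (C\<^sup>2 * real k powr (-1 - \<delta>))"
        by (intro mult_left_mono) auto
      then show "(norm ((T ^^ k) x))\<^sup>2 - (norm ((T ^^ Suc k) x))\<^sup>2 \<le> K * real k powr (-1 - \<delta>)"
        using loss_le_defect[of "(T ^^ k) x"] by (simp add: K_def loss_def mult_ac)
    qed (use \<delta> n in \<open>auto simp: K_def\<close>)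
    also have "real n powr (-\<delta>) = (real n powr (-\<delta> / 2))\<^sup>2"
      by (simp add: power2_eq_square flip: powr_add)
    finally have "(norm ((T ^^ n) x))\<^sup>2 \<le> (sqrt B * real n powr (-\<delta> / 2))\<^sup>2"
      using B by (simp add: B_def power_mult_distrib)
    then show ?thesis
      by (rule power2_le_imp_le) (use B in simp)
  qed
  then show "\<exists>C\<ge>0. \<forall>k\<ge>1. norm ((T ^^ k) x) \<le> C * real k powr (-1/2 - \<epsilon>)"
    unfolding \<delta>(3) using B by (intro exI[of _ "sqrt B"]) auto
qed

end

section \<open>The component in the intersection\<close>

context closed_subspaces
begin

lemma common_part_fixed:
  assumes c: "c \<in> common_part M m"
  shows "T c = c"
proof -
  have "proj_prod M n c = c" if "n \<le> m" for n
    using that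
  proof (induction n)
    case (Suc n)
    then have "c \<in> M (Suc n)"
      using c by (auto simp: common_part_def)
    then show ?case
      using Suc by (simp add: orth_proj_fix M_Suc)
  qed simp
  then show ?thesis
    by simp
qed

text \<open>
  The component in the intersection is carried along unchanged, so the rates on \<open>\<Sum>\<^sub>i M\<^sub>i\<^sup>\<bottom>\<close> pass to
  all points of \<open>good_starts M m\<close>.
\<close>
lemma iter_add_common_part:
  assumes "c \<in> common_part M m"
  shows "(T ^^ k) (c + x) = c + (T ^^ k) x"
proof -
  have "(T ^^ k) c = c"
    by (induction k) (simp_all add: common_part_fixed[OF assms])
  then show ?thesis
    by (simp add: linear_simps[OF bounded_linear_iter])
qed

lemma defect_add_common_part:
  assumes c: "c \<in> common_part M m"
  shows "defect (c + x) = defect x"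
proof -
  have eq: "residual (Suc i) (c + x) = residual (Suc i) x" if i: "i < m" for i
  proof -
    have "c \<in> M (Suc i)"
      using c i by (auto simp: common_part_def)
    then show ?thesis
      using linear_simps(1)[OF bounded_linear_orth_proj[OF M_Suc(1)[OF i] M_Suc(2)[OF i]], of c x]
        orth_proj_fix[OF M_Suc(1)[OF i] M_Suc(2)[OF i]] by simp
  qed
  show ?thesis
    unfolding defect_def by (intro sum.cong refl) (simp only: eq lessThan_iff)
qed

lemma orth_proj_common_part:
  assumes c: "c \<in> common_part M m" and x: "x \<in> perp_sum M m"
  shows "orth_proj (common_part M m) (c + x) = c"
proof (rule orth_proj_eqI)
  show "subspace (common_part M m)"
    unfolding common_part_def by (intro subspace_Inter) (auto intro: subspace_M)
  obtain u where u: "\<forall>i<m. u i \<in> (M (Suc i))\<^sup>\<bottom>" "x = (\<Sum>i<m. u i)"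
    using x unfolding perp_sum_iff by blast
  have "x \<bullet> y = 0" if y: "y \<in> common_part M m" for y
    unfolding u(2) inner_sum_left
  proof (rule sum.neutral, rule ballI)
    fix i
    assume "i \<in> {..<m}"
    then show "u i \<bullet> y = 0"
      using u(1) y by (intro orthogonal_compD[of _ "M (Suc i)"]) (auto simp: common_part_def)
  qed
  then show "c + x - c \<in> (common_part M m)\<^sup>\<bottom>"
    by (intro orthogonal_compI) simp
qed (fact c)

lemma zero_in_common_part: "0 \<in> common_part M m"
  unfolding common_part_def using subspace_M subspace_0 by blast

lemma perp_sum_good_start: "x \<in> perp_sum M m \<Longrightarrow> x \<in> good_starts M m"
  using set_plus_intro[OF zero_in_common_part] by (force simp: good_starts_def)

end

theorem theorem4p3:
  fixes M :: "nat \<Rightarrow> 'a::{real_inner, complete_space} set" and m :: nat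
  assumes "1 \<le> m"
    and "\<And>i. i \<in> {1..m} \<Longrightarrow> subspace (M i)"
    and "\<And>i. i \<in> {1..m} \<Longrightarrow> closed (M i)"
  shows
   "(\<forall>y0. (\<lambda>k. norm (proj_iter M m y0 k - proj_iter M m y0 (k - 1))) \<in> o(\<lambda>k. real k powr (-1))
        \<and> (\<lambda>k. rms_dist M m (proj_iter M m y0 k)) \<in> o(\<lambda>k. real k powr (-1/2)))
  \<and> (\<forall>y0\<in>good_starts M m.
          (\<lambda>k. norm (proj_iter M m y0 k - orth_proj (common_part M m) y0)) \<in> O(\<lambda>k. real k powr (-1/2))
        \<and> (\<lambda>k. norm (proj_iter M m y0 k - proj_iter M m y0 (k - 1))) \<in> O(\<lambda>k. real k powr (-3/2))
        \<and> (\<lambda>k. rms_dist M m (proj_iter M m y0 k)) \<in> O(\<lambda>k. real k powr (-1)))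
  \<and> (\<not> closed (perp_sum M m) \<longrightarrow>
      (\<forall>\<epsilon>::real. \<epsilon> > 0 \<longrightarrow>
          \<not> (\<forall>y0. (\<lambda>k. norm (proj_iter M m y0 k - proj_iter M m y0 (k - 1)))
                    \<in> o(\<lambda>k. real k powr (-1 - \<epsilon>)))
        \<and> \<not> (\<forall>y0. (\<lambda>k. rms_dist M m (proj_iter M m y0 k))
                    \<in> o(\<lambda>k. real k powr (-1/2 - \<epsilon>)))
        \<and> \<not> (\<forall>y0\<in>good_starts M m. (\<lambda>k. norm (proj_iter M m y0 k - orth_proj (common_part M m) y0))
                    \<in> O(\<lambda>k. real k powr (-1/2 - \<epsilon>)))
        \<and> \<not> (\<forall>y0\<in>good_starts M m. (\<lambda>k. norm (proj_iter M m y0 k - proj_iter M m y0 (k - 1)))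
                    \<in> O(\<lambda>k. real k powr (-3/2 - \<epsilon>)))
        \<and> \<not> (\<forall>y0\<in>good_starts M m. (\<lambda>k. rms_dist M m (proj_iter M m y0 k))
                    \<in> O(\<lambda>k. real k powr (-1 - \<epsilon>)))))"
proof -
  interpret closed_subspaces M m
    using assms(2,3) by (rule closed_subspaces.intro)
  have m: "sqrt (1 / real m) \<noteq> 0"
    using assms(1) by simp
  have big: "\<exists>C\<ge>0. \<forall>k\<ge>1. \<bar>f k\<bar> \<le> C * real k powr q" if "f \<in> O(\<lambda>k. real k powr q)" for f q
    using that by (simp only: bigo_powr_iff)
  note small = big[OF landau_o.small_imp_big]
  show ?thesis
  proof (intro conjI allI ballI impI)
    fix y0
    show "(\<lambda>k. norm (proj_iter M m y0 k - proj_iter M m y0 (k - 1))) \<in> o(\<lambda>k. real k powr (-1))"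
      unfolding proj_iter_def by (rule displacement_smallo)
    show "(\<lambda>k. rms_dist M m (proj_iter M m y0 k)) \<in> o(\<lambda>k. real k powr (-1/2))"
      unfolding proj_iter_def rms_dist_eq using defect_smallo[of y0] m by simp
  next
    fix y0
    assume "y0 \<in> good_starts M m"
    then obtain c x where c: "c \<in> common_part M m" and x: "x \<in> perp_sum M m" and y0: "y0 = c + x"
      unfolding good_starts_def by (elim set_plus_elim)
    show "(\<lambda>k. norm (proj_iter M m y0 k - orth_proj (common_part M m) y0)) \<in> O(\<lambda>k. real k powr (-1/2))"
      using iter_perp_sum_bound[OF x]
      by (simp add: y0 proj_iter_def iter_add_common_part[OF c] orth_proj_common_part[OF c x] bigo_powr_iff)
    show "(\<lambda>k. norm (proj_iter M m y0 k - proj_iter M m y0 (k - 1))) \<in> O(\<lambda>k. real k powr (-3/2))"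
      using displacement_perp_sum_bound[OF x]
      by (simp add: y0 proj_iter_def iter_add_common_part[OF c] bigo_powr_iff)
    show "(\<lambda>k. rms_dist M m (proj_iter M m y0 k)) \<in> O(\<lambda>k. real k powr (-1))"
      using defect_perp_sum_bound[OF x] m
      by (simp add: y0 proj_iter_def iter_add_common_part[OF c] defect_add_common_part[OF c] rms_dist_eq)
  next
    fix \<epsilon> :: real
    assume nc: "\<not> closed (perp_sum M m)" and \<epsilon>: "0 < \<epsilon>"
    show "\<not> (\<forall>y0. (\<lambda>k. norm (proj_iter M m y0 k - proj_iter M m y0 (k - 1)))
        \<in> o(\<lambda>k. real k powr (-1 - \<epsilon>)))"
    proof
      assume "\<forall>y0. (\<lambda>k. norm (proj_iter M m y0 k - proj_iter M m y0 (k - 1))) \<in> o(\<lambda>k. real k powr (-1 - \<epsilon>))"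
      from small[OF spec[OF this]] have "closed (perp_sum M m)"
        by (intro closed_perp_sum_if_displacement_decay[OF \<epsilon>]) (simp add: proj_iter_def)
      with nc show False ..
    qed
    show "\<not> (\<forall>y0. (\<lambda>k. rms_dist M m (proj_iter M m y0 k)) \<in> o(\<lambda>k. real k powr (-1/2 - \<epsilon>)))"
    proof
      assume "\<forall>y0. (\<lambda>k. rms_dist M m (proj_iter M m y0 k)) \<in> o(\<lambda>k. real k powr (-1/2 - \<epsilon>))"
      then have "(\<lambda>k. sqrt (defect ((T ^^ k) y0))) \<in> o(\<lambda>k. real k powr (-1/2 - \<epsilon>))" for y0
        using m by (simp add: proj_iter_def rms_dist_eq)
      from small[OF this] have "closed (perp_sum M m)"
        by (intro closed_perp_sum_if_defect_decay[OF \<epsilon>]) (simp add: defect_nonneg)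
      with nc show False ..
    qed
    show "\<not> (\<forall>y0\<in>good_starts M m. (\<lambda>k. norm (proj_iter M m y0 k - orth_proj (common_part M m) y0))
        \<in> O(\<lambda>k. real k powr (-1/2 - \<epsilon>)))"
    proof
      assume *: "\<forall>y0\<in>good_starts M m. (\<lambda>k. norm (proj_iter M m y0 k - orth_proj (common_part M m) y0))
        \<in> O(\<lambda>k. real k powr (-1/2 - \<epsilon>))"
      have "closed (perp_sum M m)"
      proof (rule closed_perp_sum_if_iter_decay[OF \<epsilon>])
        fix x
        assume x: "x \<in> perp_sum M m"
        then show "\<exists>C\<ge>0. \<forall>k\<ge>1. norm ((T ^^ k) x) \<le> C * real k powr (-1/2 - \<epsilon>)"
          using big[OF bspec[OF * perp_sum_good_start[OF x]]]
            orth_proj_common_part[OF zero_in_common_part x] by (simp add: proj_iter_def)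
      qed
      with nc show False ..
    qed
    show "\<not> (\<forall>y0\<in>good_starts M m. (\<lambda>k. norm (proj_iter M m y0 k - proj_iter M m y0 (k - 1)))
        \<in> O(\<lambda>k. real k powr (-3/2 - \<epsilon>)))"
    proof
      assume *: "\<forall>y0\<in>good_starts M m. (\<lambda>k. norm (proj_iter M m y0 k - proj_iter M m y0 (k - 1)))
        \<in> O(\<lambda>k. real k powr (-3/2 - \<epsilon>))"
      have "closed (perp_sum M m)"
        using big[OF bspec[OF * perp_sum_good_start]]
        by (intro closed_perp_sum_if_displacement_decay_perp_sum[OF \<epsilon>]) (simp add: proj_iter_def)
      with nc show False ..
    qed
    show "\<not> (\<forall>y0\<in>good_starts M m. (\<lambda>k. rms_dist M m (proj_iter M m y0 k))
        \<in> O(\<lambda>k. real k powr (-1 - \<epsilon>)))"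
    proof
      assume "\<forall>y0\<in>good_starts M m. (\<lambda>k. rms_dist M m (proj_iter M m y0 k))
        \<in> O(\<lambda>k. real k powr (-1 - \<epsilon>))"
      then have "(\<lambda>k. sqrt (defect ((T ^^ k) x))) \<in> O(\<lambda>k. real k powr (-1 - \<epsilon>))"
        if "x \<in> perp_sum M m" for x
        using perp_sum_good_start[OF that] m by (simp add: proj_iter_def rms_dist_eq)
      from big[OF this] have "closed (perp_sum M m)"
        by (intro closed_perp_sum_if_defect_decay_perp_sum[OF \<epsilon>]) (simp add: defect_nonneg)
      with nc show False ..
    qed
  qed
qed

end
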